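(* Let $p,q\in\mathbb{N}$ be co-prime and $\theta=\tan^{-1}(p/q)$. Then $$1>\dim(\mu_\theta)\ge\log 9-\frac{P(l_{pq},T|_{l_{pq}},\phi)}{\log 2}.$$
   Context: Let $D=\{0,1,p/q\}$ with $p/q\in[0,1]$. $\mu_\theta$ is the unique Borel probability measure on $\mathbb{R}$ with $\mu_\theta(A)=\tfrac13(\mu_\theta(2A)+\mu_\theta(2A-1)+\mu_\theta(2A-p/q))$, i.e. the law of $\sum_{i\ge1}a_i2^{-i}$ with $a_i$ i.i.d. uniform on $D$; $\dim(\mu_\theta)$ is its (Hausdorff) dimension as a measure. Let $B=\{(0,0),(1,0),(0,1),(1,1)\}$, ordered in this way to index rows/columns $1,\dots,4$, and define $A_{(0,0)}=\begin{pmatrix}3&1&1&1\\0&1&0&0\\0&0&1&0\\0&0&0&1\end{pmatrix}$, $A_{(1,0)}=\begin{pmatrix}1&0&1&0\\1&3&0&1\\0&0&0&0\\0&0&1&1\end{pmatrix}$, $A_{(0,1)}=\begin{pmatrix}1&1&0&0\\0&0&0&0\\1&0&3&1\\0&1&0&1\end{pmatrix}$, $A_{(1,1)}=\begin{pmatrix}1&0&0&0\\0&1&0&0\\0&0&1&0\\1&1&1&3\end{pmatrix}$. For $z\in B^{\mathbb{N}}$, $\phi(z)=\limsup_{n\to\infty}\log\frac{(1,1,1,1)A_{z_1}\cdots A_{z_n}(1,0,0,0)^T}{(1,1,1,1)A_{z_2}\cdots A_{z_n}(1,0,0,0)^T}$. For a word $\omega$ over $B$, $\pi(\omega)=\sum_i\omega_i2^{-i}\in\mathbb{R}^2$.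 The extended line is $l_{pq}=\{(x,y):\exists x',y',\ x\equiv x',y\equiv y'\pmod1,\ \tfrac pq x'=y'\}$; $X^n_\theta=\{x\in B^n:\pi(x)\in l_{pq}\}$, $X^{\mathbb{N}}_\theta=\{\omega\in B^{\mathbb{N}}:\pi(\omega)\in l_{pq}\}$, $\sigma$ the left shift, and $[i_1\cdots i_n]$ the set of $\omega\in X^{\mathbb{N}}_\theta$ beginning with $i_1\cdots i_n$. The pressure of $\phi$ for the doubling map $T(x,y)=(2x\bmod 1,2y\bmod1)$ restricted to $l_{pq}$ (coded by $\sigma$ on $X^{\mathbb{N}}_\theta$) is $$P(l_{pq},T|_{l_{pq}},\phi)=\lim_{n\to\infty}\frac1n\log\Big(\sum_{i_1\cdots i_n\in X^n_\theta}\exp\Big(\sup_{\omega\in[i_1\cdots i_n]}\sum_{j=0}^{n-1}\phi(\sigma^j\omega)\Big)\Big).$$ *)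

theory Defs
  imports "HOL-Analysis.Analysis" "HOL-Probability.Probability"
begin

definition hcontent :: "real \<Rightarrow> real \<Rightarrow> real set \<Rightarrow> ennreal" where
  "hcontent s \<delta> A = (INF U \<in> {U :: nat \<Rightarrow> real set. A \<subseteq> (\<Union>i. U i) \<and>
        (\<forall>i. bounded (U i) \<and> diameter (U i) \<le> \<delta>)}. (\<Sum>i. ennreal (diameter (U i) powr s)))"

definition hmeasure :: "real \<Rightarrow> real set \<Rightarrow> ennreal" where
  "hmeasure s A = (SUP \<delta> \<in> {0<..}. hcontent s \<delta> A)"

definition hdim :: "real set \<Rightarrow> real" where
  "hdim A = Inf {s. 0 < s \<and> hmeasure s A = 0}"

definition measure_dim :: "real measure \<Rightarrow> real" where
  "measure_dim \<mu> = Inf {hdim A | A. A \<in> sets \<mu> \<and> emeasure \<mu> A > 0}"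

definition digB :: "(nat \<times> nat) set" where
  "digB = {(0,0),(1,0),(0,1),(1,1)}"

text \<open>Matrices indexed by 0..3 (row, column), corresponding to rows/columns 1..4.\<close>
definition Amat :: "nat \<times> nat \<Rightarrow> nat \<Rightarrow> nat \<Rightarrow> real" where
  "Amat d i j = real (
     (if d = (0,0) then [[3,1,1,1],[0,1,0,0],[0,0,1,0],[0,0,0,1]]
      else if d = (1,0) then [[1,0,1,0],[1,3,0,1],[0,0,0,0],[0,0,1,1]]
      else if d = (0,1) then [[1,1,0,0],[0,0,0,0],[1,0,3,1],[0,1,0,1]]
      else [[1,0,0,0],[0,1,0,0],[0,0,1,0],[1,1,1,3::nat]]) ! i ! j)"

definition vecmat :: "(nat \<Rightarrow> real) \<Rightarrow> (nat \<Rightarrow> nat \<Rightarrow> real) \<Rightarrow> nat \<Rightarrow> real" where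
  "vecmat v M = (\<lambda>j. \<Sum>i<4. v i * M i j)"

definition wordval :: "(nat \<times> nat) list \<Rightarrow> real" where
  "wordval w = foldl (\<lambda>v d. vecmat v (Amat d)) (\<lambda>_. 1) w 0"

text \<open>phi(z) = limsup log ratio; z_1 is z 0. The ratio lies in [1,4], so the limsup is finite.\<close>
definition phi :: "(nat \<Rightarrow> nat \<times> nat) \<Rightarrow> real" where
  "phi z = real_of_ereal (limsup (\<lambda>n. ereal (ln (wordval (map z [0..<n]) / wordval (map z [1..<n])))))"

definition piw :: "(nat \<times> nat) list \<Rightarrow> real \<times> real" where
  "piw w = ((\<Sum>i<length w. real (fst (w ! i)) / 2 ^ (i+1)), (\<Sum>i<length w. real (snd (w ! i)) / 2 ^ (i+1)))"

definition pis :: "(nat \<Rightarrow> nat \<times> nat) \<Rightarrow> real \<times> real" where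
  "pis \<omega> = ((\<Sum>i. real (fst (\<omega> i)) / 2 ^ (i+1)), (\<Sum>i. real (snd (\<omega> i)) / 2 ^ (i+1)))"

definition lpq :: "nat \<Rightarrow> nat \<Rightarrow> (real \<times> real) set" where
  "lpq p q = {(x, y). \<exists>x' y'. x - x' \<in> \<int> \<and> y - y' \<in> \<int> \<and> (real p / real q) * x' = y'}"

definition Xn :: "nat \<Rightarrow> nat \<Rightarrow> nat \<Rightarrow> (nat \<times> nat) list set" where
  "Xn p q n = {x. length x = n \<and> set x \<subseteq> digB \<and> piw x \<in> lpq p q}"

definition XN :: "nat \<Rightarrow> nat \<Rightarrow> (nat \<Rightarrow> nat \<times> nat) set" where
  "XN p q = {\<omega>. (\<forall>i. \<omega> i \<in> digB) \<and> pis \<omega> \<in> lpq p q}"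

definition cyl :: "nat \<Rightarrow> nat \<Rightarrow> (nat \<times> nat) list \<Rightarrow> (nat \<Rightarrow> nat \<times> nat) set" where
  "cyl p q w = {\<omega> \<in> XN p q. \<forall>i < length w. \<omega> i = w ! i}"

definition shiftn :: "nat \<Rightarrow> (nat \<Rightarrow> 'a) \<Rightarrow> nat \<Rightarrow> 'a" where
  "shiftn j \<omega> = (\<lambda>i. \<omega> (i + j))"

definition pressure :: "nat \<Rightarrow> nat \<Rightarrow> real" where
  "pressure p q = lim (\<lambda>n. (1 / real n) * ln (\<Sum>w \<in> Xn p q n.
       exp (Sup ((\<lambda>\<omega>. \<Sum>j<n. phi (shiftn j \<omega>)) ` cyl p q w))))"

definition is_mu_theta :: "nat \<Rightarrow> nat \<Rightarrow> real measure \<Rightarrow> bool" where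
  "is_mu_theta p q \<mu> \<longleftrightarrow> sets \<mu> = sets borel \<and> prob_space \<mu> \<and>
     (\<forall>A \<in> sets borel. emeasure \<mu> A =
        (emeasure \<mu> ((\<lambda>x. 2 * x) ` A) + emeasure \<mu> ((\<lambda>x. 2 * x - 1) ` A)
         + emeasure \<mu> ((\<lambda>x. 2 * x - real p / real q) ` A)) / 3)"

end

theory Submission
  imports Defs
begin

text \<open>
  Let \<open>s(a)\<close> be the dyadic sum of a digit word \<open>a\<close> of length \<open>n\<close> over \<open>{0, 1, p/q}\<close>. The entries of
  the row vector \<open>(1,1,1,1) A\<^sub>w\<close> count the pairs of words whose difference, as a pair of points of the
  Sierpinski gasket, is congruent to a corner of the dyadic square of \<open>w\<close>; summed over the squares
  with a corner on the line they count, up to a bounded factor, the pairs with \<open>s(a) = s(b)\<close>.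
  Quotients of such row vectors are contracted by every product of two of the matrices, hence the
  Birkhoff sums of \<open>\<phi>\<close> differ from \<open>ln wordval\<close> by a bounded amount. So the pressure exists and is
  the exponential growth rate of the (supermultiplicative) number of collisions, that is, the
  \<open>L\<^sup>2\<close> dimension of \<open>\<mu>\<close> is \<open>log 2 9 - P / ln 2\<close>; by the mass distribution principle it is a lower
  bound for the Hausdorff dimension of every set of positive measure.

  For the strict upper bound, let \<open>c\<close> be the Fourier coefficient of \<open>\<mu>\<close> at frequency \<open>q\<close>. It is not
  zero, since \<open>1 + u + v = 0\<close> has no solution in roots of unity of order a power of two, and by
  self-similarity it is also the coefficient at the frequencies \<open>2\<^sup>j q\<close>. So the averages of
  \<open>cos (2 \<pi> 2\<^sup>j q x - arg c)\<close> over \<open>j < n\<close> have mean \<open>\<bar>c\<bar>\<close> and are at least \<open>\<bar>c\<bar>/2\<close> with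
  probability at least \<open>\<bar>c\<bar>/2\<close>. A Riesz product shows that this event is covered by an exponentially
  small proportion of the dyadic intervals of level \<open>n\<close>, so its limit superior has dimension below 1.
\<close>

section \<open>Contraction of the matrix products\<close>

definition vvec :: "(nat \<times> nat) list \<Rightarrow> nat \<Rightarrow> real" where
  "vvec w = foldl (\<lambda>v d. vecmat v (Amat d)) (\<lambda>_. 1) w"

lemma vvec_Nil [simp]: "vvec [] = (\<lambda>_. 1)"
  by (simp add: vvec_def)

lemma vvec_snoc: "vvec (w @ [d]) = vecmat (vvec w) (Amat d)"
  by (simp add: vvec_def)

lemma wordval_eq_vvec: "wordval w = vvec w 0"
  by (simp add: wordval_def vvec_def)

lemma lessThan_4: "{..<4::nat} = {0, 1, 2, 3}"
  by auto

lemma nat_less_4E: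
  assumes "(c::nat) < 4"
  obtains "c = 0" | "c = 1" | "c = 2" | "c = 3"
  using assms by linarith

lemma digBE:
  assumes "d \<in> digB"
  obtains "d = (0,0)" | "d = (1,0)" | "d = (0,1)" | "d = (1,1)"
  using assms by (auto simp: digB_def)

lemma vecmat_Amat:
  "vecmat v (Amat (0,0)) 0 = 3 * v 0"
  "vecmat v (Amat (0,0)) 1 = v 0 + v 1"
  "vecmat v (Amat (0,0)) 2 = v 0 + v 2"
  "vecmat v (Amat (0,0)) 3 = v 0 + v 3"
  "vecmat v (Amat (1,0)) 0 = v 0 + v 1"
  "vecmat v (Amat (1,0)) 1 = 3 * v 1"
  "vecmat v (Amat (1,0)) 2 = v 0 + v 3"
  "vecmat v (Amat (1,0)) 3 = v 1 + v 3"
  "vecmat v (Amat (0,1)) 0 = v 0 + v 2"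
  "vecmat v (Amat (0,1)) 1 = v 0 + v 3"
  "vecmat v (Amat (0,1)) 2 = 3 * v 2"
  "vecmat v (Amat (0,1)) 3 = v 2 + v 3"
  "vecmat v (Amat (1,1)) 0 = v 0 + v 3"
  "vecmat v (Amat (1,1)) 1 = v 1 + v 3"
  "vecmat v (Amat (1,1)) 2 = v 2 + v 3"
  "vecmat v (Amat (1,1)) 3 = 3 * v 3"
  by (simp_all add: vecmat_def lessThan_4 Amat_def)

lemma all_less_4: "(\<forall>c<4::nat. P c) \<longleftrightarrow> P 0 \<and> P 1 \<and> P 2 \<and> P 3"
  by (auto elim!: nat_less_4E)

text \<open>Indices 0, ..., 3 stand for the corners of a unit square; every pair of corners
  except 1 and 2 differs by a vector that is itself a difference of two digits.\<close>
definition balanced :: "(nat \<Rightarrow> real) \<Rightarrow> bool" where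
  "balanced v \<longleftrightarrow> 0 < v 0 \<and> 0 < v 1 \<and> 0 < v 2 \<and> 0 < v 3 \<and>
     v 0 \<le> 2 * v 1 \<and> v 1 \<le> 2 * v 0 \<and> v 0 \<le> 2 * v 2 \<and> v 2 \<le> 2 * v 0 \<and>
     v 0 \<le> 2 * v 3 \<and> v 3 \<le> 2 * v 0 \<and> v 1 \<le> 2 * v 3 \<and> v 3 \<le> 2 * v 1 \<and>
     v 2 \<le> 2 * v 3 \<and> v 3 \<le> 2 * v 2"

text \<open>The factor 2 reproduces itself: for the digit (0,0), for instance,
  \<open>3 * v 0 \<le> 2 * (v 0 + v 1)\<close> says exactly \<open>v 0 \<le> 2 * v 1\<close>, and
  the other inequalities follow linearly from the old ones.\<close>

lemma balanced_vecmat: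
  assumes "balanced v" "d \<in> digB"
  shows "balanced (vecmat v (Amat d))"
  using assms(2)
  by (rule digBE; use assms(1) in \<open>simp add: balanced_def vecmat_Amat del: One_nat_def\<close>)

lemma balanced_vvec:
  assumes "set w \<subseteq> digB"
  shows "balanced (vvec w)"
  using assms
proof (induction w rule: rev_induct)
  case Nil
  then show ?case by (simp add: balanced_def)
next
  case (snoc d w)
  then show ?case by (auto simp: vvec_snoc intro: balanced_vecmat)
qed

lemma balanced_pos: "balanced v \<Longrightarrow> c < 4 \<Longrightarrow> 0 < v c"
  by (erule nat_less_4E) (simp_all add: balanced_def del: One_nat_def)

text \<open>Only the pair 1, 2 lacks a direct bound; passing through corner 0 costs the factor 2
  twice.\<close>

lemma balanced_ratio:
  assumes "balanced v" "i < 4" "j < 4"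
  shows "v i \<le> 4 * v j"
proof -
  have "\<forall>i<4. \<forall>j<4. v i \<le> 4 * v j"
    unfolding all_less_4 using assms(1) by (simp add: balanced_def del: One_nat_def)
  then show ?thesis using assms(2,3) by blast
qed

text \<open>The entries are nonnegative and every column sum is 2 or 3.\<close>

lemma vecmat_le:
  assumes "\<And>c. c < 4 \<Longrightarrow> v c \<le> K" "0 \<le> K" "d \<in> digB" "c < 4"
  shows "vecmat v (Amat d) c \<le> 3 * K"
proof -
  have *: "v 0 \<le> K" "v 1 \<le> K" "v 2 \<le> K" "v 3 \<le> K"
    using assms(1) by auto
  have "\<forall>c<4. vecmat v (Amat d) c \<le> 3 * K"
    unfolding all_less_4
    by (rule digBE[OF assms(3)];
        use * assms(2) in \<open>simp add: vecmat_Amat del: One_nat_def\<close>)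
  then show ?thesis using assms(4) by blast
qed

lemma vecmat2_bound:
  assumes "balanced v" "d \<in> digB" "e \<in> digB" "c < 4" "i < 4"
  shows "vecmat (vecmat v (Amat d)) (Amat e) c \<le> 36 * v i"
proof -
  have "v i > 0" using assms balanced_pos by blast
  then have "vecmat (vecmat v (Amat d)) (Amat e) c \<le> 3 * (3 * (4 * v i))"
    using balanced_ratio[OF assms(1) _ assms(5)] assms(2-4) by (intro vecmat_le) auto
  then show ?thesis by simp
qed

lemma vecmat_nonneg:
  assumes "\<And>c. c < 4 \<Longrightarrow> 0 \<le> v c" "d \<in> digB" "c < 4"
  shows "0 \<le> vecmat v (Amat d) c"
proof -
  have "Amat d i c \<ge> 0" for i by (simp add: Amat_def)
  then show ?thesis unfolding vecmat_def using assms by (auto intro!: sum_nonneg)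
qed

text \<open>The matrices of (1,0) and (0,1) have no positive row, but every product of two matrices
  has one; its entries are integers, hence at least 1.\<close>

lemma pivot_row:
  assumes "d \<in> digB" "e \<in> digB"
  obtains i where "i < 4"
    "\<And>v c. (\<And>c. c < 4 \<Longrightarrow> 0 \<le> v c) \<Longrightarrow> c < 4 \<Longrightarrow> v i \<le> vecmat (vecmat v (Amat d)) (Amat e) c"
proof -
  \<comment> \<open>Row 0 for (0,0) and row 3 for (1,1) are positive already. Row 1 for (1,0)
    vanishes only in column 2, which is fatal only if the next digit is (0,1), whose column 2 is
    supported on row 2; row 0 works then. The digit (0,1) is the mirror image.\<close>
  define i :: nat where
    "i = (if d = (0,0) then 0 else if d = (1,1) then 3
          else if d = (1,0) then (if e = (0,1) then 0 else 1)
          else (if e = (1,0) then 0 else 2))"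
  show ?thesis
  proof (rule that)
    show "i < 4" by (simp add: i_def)
    fix v :: "nat \<Rightarrow> real" and c :: nat
    assume *: "\<And>c. c < 4 \<Longrightarrow> 0 \<le> v c" "c < 4"
    then have nonneg: "0 \<le> v 0" "0 \<le> v 1" "0 \<le> v 2" "0 \<le> v 3" by auto
    have "\<forall>c<4. v i \<le> vecmat (vecmat v (Amat d)) (Amat e) c"
      unfolding all_less_4 i_def
      by (rule digBE[OF assms(1)]; rule digBE[OF assms(2)];
          use nonneg in \<open>simp add: vecmat_Amat del: One_nat_def\<close>)
    then show "v i \<le> vecmat (vecmat v (Amat d)) (Amat e) c" using * by blast
  qed
qed

lemma vecmat_diff: "vecmat (\<lambda>c. x c - k * y c) M = (\<lambda>c. vecmat x M c - k * vecmat y M c)"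
  by (simp add: vecmat_def fun_eq_iff sum_subtractf sum_distrib_left algebra_simps)

lemma vecmat_diff': "vecmat (\<lambda>c. k * y c - x c) M = (\<lambda>c. k * vecmat y M c - vecmat x M c)"
  by (simp add: vecmat_def fun_eq_iff sum_subtractf sum_distrib_left algebra_simps)

section \<open>Intervals for the quotients of row vectors\<close>

definition between :: "real \<Rightarrow> real \<Rightarrow> (nat \<Rightarrow> real) \<Rightarrow> (nat \<Rightarrow> real) \<Rightarrow> bool" where
  "between lo hi a b \<longleftrightarrow> (\<forall>c<4. lo * b c \<le> a c \<and> a c \<le> hi * b c)"

text \<open>The inequalities say that \<open>a - lo * b\<close> and \<open>hi * b - a\<close> are
  nonnegative, and matrices with nonnegative entries preserve this.\<close>

lemma between_vecmat:
  assumes "between lo hi a b" "d \<in> digB"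
  shows "between lo hi (vecmat a (Amat d)) (vecmat b (Amat d))"
  unfolding between_def
proof (intro allI impI)
  fix c :: nat assume "c < 4"
  have "0 \<le> vecmat (\<lambda>c. a c - lo * b c) (Amat d) c"
    by (rule vecmat_nonneg) (use assms \<open>c < 4\<close> in \<open>auto simp: between_def\<close>)
  moreover have "0 \<le> vecmat (\<lambda>c. hi * b c - a c) (Amat d) c"
    by (rule vecmat_nonneg) (use assms \<open>c < 4\<close> in \<open>auto simp: between_def\<close>)
  ultimately show "lo * vecmat b (Amat d) c \<le> vecmat a (Amat d) c \<and>
      vecmat a (Amat d) c \<le> hi * vecmat b (Amat d) c"
    by (simp add: vecmat_diff vecmat_diff')
qed

text \<open>The product of any two of the matrices has a strictly positive row, so two steps
  contract the range of the quotients by a fixed factor.\<close>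
lemma between_contract:
  assumes ab: "between lo hi a b" and bal: "balanced b" and "d \<in> digB" "e \<in> digB" and le: "lo \<le> hi"
  obtains lo' hi' where "lo \<le> lo'" "lo' \<le> hi'" "hi' \<le> hi" "hi' - lo' = 71/72 * (hi - lo)"
    "between lo' hi' (vecmat (vecmat a (Amat d)) (Amat e)) (vecmat (vecmat b (Amat d)) (Amat e))"
proof -
  obtain i where i: "i < 4"
    "\<And>v c. (\<And>c. c < 4 \<Longrightarrow> 0 \<le> v c) \<Longrightarrow> c < 4 \<Longrightarrow> v i \<le> vecmat (vecmat v (Amat d)) (Amat e) c"
    using pivot_row[OF assms(3,4)] by metis
  define a2 where "a2 = vecmat (vecmat a (Amat d)) (Amat e)"
  define b2 where "b2 = vecmat (vecmat b (Amat d)) (Amat e)"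
  have btw: "between lo hi a2 b2"
    unfolding a2_def b2_def using assms by (intro between_vecmat)
  have b2: "b2 c \<le> 36 * b i" if "c < 4" for c
    unfolding b2_def using vecmat2_bound[OF bal assms(3,4) that i(1)] .
  have x: "a i - lo * b i \<le> a2 c - lo * b2 c" if "c < 4" for c
    using i(2)[of "\<lambda>c. a c - lo * b c" c] that ab
    by (simp add: vecmat_diff between_def a2_def b2_def)
  have y: "hi * b i - a i \<le> hi * b2 c - a2 c" if "c < 4" for c
    using i(2)[of "\<lambda>c. hi * b c - a c" c] that ab
    by (simp add: vecmat_diff' between_def a2_def b2_def)
  \<comment> \<open>Each \<open>b2 c\<close> is at most 36 times \<open>b i\<close>, so half of the
    gap at \<open>i\<close> is enough to move an endpoint by 1/72 of the length in every
    column.\<close>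
  have scale: "(hi - lo) / 72 * b2 c \<le> (hi - lo) * b i / 2" if "c < 4" for c
    proof -
    have "(hi - lo) / 72 * b2 c \<le> (hi - lo) / 72 * (36 * b i)"
      by (rule mult_left_mono[OF b2[OF that]]) (use le in simp)
    also have "\<dots> = (hi - lo) * b i / 2" by simp
    finally show ?thesis .
  qed
  show ?thesis
  \<comment> \<open>If the quotient at \<open>i\<close> lies in the upper half of the interval, the
    lower endpoint can be raised; otherwise the upper one can be lowered.\<close>
  proof (cases "a i - lo * b i \<ge> (hi - lo) * b i / 2")
    case True
    have "between (lo + (hi - lo) / 72) hi a2 b2"
      unfolding between_def
    proof (intro allI impI conjI)
      fix c :: nat assume c: "c < 4"
      show "(lo + (hi - lo) / 72) * b2 c \<le> a2 c"
        using x[OF c] scale[OF c] True unfolding distrib_right by linarith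
      show "a2 c \<le> hi * b2 c" using btw c by (simp add: between_def)
    qed
    then show ?thesis
      using le by (intro that[of "lo + (hi - lo) / 72" hi]) (auto simp: a2_def b2_def field_simps)
  next
    case False
    have "between lo (hi - (hi - lo) / 72) a2 b2"
      unfolding between_def
    proof (intro allI impI conjI)
      fix c :: nat assume c: "c < 4"
      show "a2 c \<le> (hi - (hi - lo) / 72) * b2 c"
        using y[OF c] scale[OF c] False
          left_diff_distrib[of hi "(hi - lo) / 72" "b2 c"] left_diff_distrib[of hi lo "b i"]
        by linarith
      show "lo * b2 c \<le> a2 c" using btw c by (simp add: between_def)
    qed
    then show ?thesis
      using le by (intro that[of lo "hi - (hi - lo) / 72"]) (auto simp: a2_def b2_def field_simps)
  qed
qed

lemma between_vvec_mono:
  assumes z: "\<And>i. z i \<in> digB" and "1 \<le> n" "n \<le> m"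
    and "between lo hi (vvec (map z [0..<n])) (vvec (map z [1..<n]))"
  shows "between lo hi (vvec (map z [0..<m])) (vvec (map z [1..<m]))"
  using assms(3,4)
proof (induction m rule: dec_induct)
  case base
  then show ?case .
next
  case (step m)
  have "between lo hi (vecmat (vvec (map z [0..<m])) (Amat (z m))) (vecmat (vvec (map z [1..<m])) (Amat (z m)))"
    using step z by (intro between_vecmat) auto
  then show ?case
    using step.hyps assms(2) by (simp add: vvec_snoc)
qed

text \<open>The first digit produces column sums, hence the interval from 2 to 3; every further pair
  of digits shrinks it by 71/72. The bound \<open>2 \<le> lo\<close> keeps the quotients in the
  range where \<open>ln\<close> is 1-Lipschitz.\<close>

lemma quotient_interval:
  assumes z: "\<And>i. z i \<in> digB"
  shows "\<exists>lo hi. 2 \<le> lo \<and> lo \<le> hi \<and> hi - lo = (71/72)^k \<and>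
    (\<forall>n\<ge>2*k+1. between lo hi (vvec (map z [0..<n])) (vvec (map z [1..<n])))"
proof (induction k)
  case 0
  have "between 2 3 (vecmat (\<lambda>_. 1) (Amat (z 0))) (\<lambda>_. 1)"
    unfolding between_def all_less_4
    by (rule digBE[OF z[of 0]]; simp add: vecmat_Amat del: One_nat_def)
  then have "between 2 3 (vvec (map z [0..<1])) (vvec (map z [1..<1]))"
    using vvec_snoc[of "[]" "z 0"] by simp
  then have "\<forall>n\<ge>1. between 2 3 (vvec (map z [0..<n])) (vvec (map z [1..<n]))"
    using between_vvec_mono[of z 1] z by blast
  then show ?case by (intro exI[of _ 2] exI[of _ 3]) auto
next
  case (Suc k)
  then obtain lo hi where IH: "2 \<le> lo" "lo \<le> hi" "hi - lo = (71/72)^k"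
    "between lo hi (vvec (map z [0..<2*k+1])) (vvec (map z [1..<2*k+1]))"
    by blast
  define n where "n = 2 * k + 1"
  have bal: "balanced (vvec (map z [1..<n]))"
    using z by (intro balanced_vvec) auto
  obtain lo' hi' where *: "lo \<le> lo'" "lo' \<le> hi'" "hi' - lo' = 71/72 * (hi - lo)"
    "between lo' hi' (vecmat (vecmat (vvec (map z [0..<n])) (Amat (z n))) (Amat (z (Suc n))))
                     (vecmat (vecmat (vvec (map z [1..<n])) (Amat (z n))) (Amat (z (Suc n))))"
    using between_contract[OF IH(4)[folded n_def] bal z z IH(2)] by metis
  have "map z [0..<Suc (Suc n)] = (map z [0..<n] @ [z n]) @ [z (Suc n)]"
    "map z [1..<Suc (Suc n)] = (map z [1..<n] @ [z n]) @ [z (Suc n)]"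
    by (simp_all add: n_def)
  then have "between lo' hi' (vvec (map z [0..<Suc (Suc n)])) (vvec (map z [1..<Suc (Suc n)]))"
    using *(4) by (simp only: vvec_snoc)
  then have "\<forall>m\<ge>2 * Suc k + 1. between lo' hi' (vvec (map z [0..<m])) (vvec (map z [1..<m]))"
    using between_vvec_mono[of z "Suc (Suc n)"] z by (auto simp: n_def)
  moreover have "hi' - lo' = (71/72)^Suc k" using *(3) IH(3) by simp
  ultimately show ?case using *(1,2) IH(1) by (meson order_trans)
qed

section \<open>The potential \<open>phi\<close> and its Birkhoff sums\<close>

lemma wordval_pos: "set w \<subseteq> digB \<Longrightarrow> 0 < wordval w"
  unfolding wordval_eq_vvec by (intro balanced_pos balanced_vvec) auto

text \<open>The shrinking intervals make the quotients a Cauchy sequence, so the limsup in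
  \<open>phi\<close> is a true limit. As \<open>ln\<close> is 1-Lipschitz on \<open>{1..}\<close>,
  the interval length bounds the error.\<close>

lemma phi_approx:
  assumes z: "\<And>i. z i \<in> digB" and "1 \<le> n"
  shows "\<bar>phi z - ln (wordval (map z [0..<n]) / wordval (map z [1..<n]))\<bar> \<le> (71/72)^((n - 1) div 2)"
proof -
  define r where "r n = wordval (map z [0..<n]) / wordval (map z [1..<n])" for n
  have *: "\<exists>lo hi. 2 \<le> lo \<and> hi - lo = (71/72)^k \<and> (\<forall>n\<ge>2*k+1. lo \<le> r n \<and> r n \<le> hi)" for k
  proof -
    obtain lo hi where h: "2 \<le> lo" "hi - lo = (71/72)^k"
      "\<And>n. n \<ge> 2*k+1 \<Longrightarrow> between lo hi (vvec (map z [0..<n])) (vvec (map z [1..<n]))"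
      using quotient_interval[of z k] z by blast
    have "lo \<le> r n \<and> r n \<le> hi" if "n \<ge> 2*k+1" for n
    proof -
      have "wordval (map z [1..<n]) > 0" using z by (intro wordval_pos) auto
      then show ?thesis
        using h(3)[OF that] by (auto simp: between_def r_def wordval_eq_vvec field_simps)
    qed
    with h show ?thesis by blast
  qed
  have "Cauchy r"
  proof (rule metric_CauchyI)
    fix e :: real assume "0 < e"
    obtain k where k: "(71/72)^k < e" 
      using real_arch_pow_inv[OF \<open>0 < e\<close>, of "71/72"] by auto
    obtain lo hi where h: "hi - lo = (71/72)^k" "\<And>n. n\<ge>2*k+1 \<Longrightarrow> lo \<le> r n \<and> r n \<le> hi"
      using *[of k] by blast
    have "dist (r m) (r n) < e" if "m \<ge> 2*k+1" "n \<ge> 2*k+1" for m n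
      using h(1) h(2)[OF that(1)] h(2)[OF that(2)] k by (auto simp: dist_real_def)
    then show "\<exists>M. \<forall>m\<ge>M. \<forall>n\<ge>M. dist (r m) (r n) < e" by blast
  qed
  then obtain L where L: "r \<longlonglongrightarrow> L" using Cauchy_convergent convergentD by blast
  \<comment> \<open>\<open>(n - 1) div 2\<close> is the largest \<open>k\<close> with
    \<open>2 * k + 1 \<le> n\<close>.\<close>
  obtain lo hi where h: "2 \<le> lo" "hi - lo = (71/72)^((n - 1) div 2)"
    "\<And>m. m \<ge> 2*((n - 1) div 2)+1 \<Longrightarrow> lo \<le> r m \<and> r m \<le> hi"
    using *[of "(n - 1) div 2"] by blast
  have n: "lo \<le> r n" "r n \<le> hi" using h(3)[of n] assms(2) by auto
  have "lo \<le> L" using h(3) by (intro LIMSEQ_le_const[OF L]) blast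
  have "L \<le> hi" using h(3) by (intro LIMSEQ_le_const2[OF L]) blast
  have "(\<lambda>n. ereal (ln (r n))) \<longlonglongrightarrow> ereal (ln L)"
    using L \<open>lo \<le> L\<close> h(1) by (intro tendsto_intros) auto
  then have "limsup (\<lambda>n. ereal (ln (r n))) = ereal (ln L)"
    by (intro lim_imp_Limsup) auto
  then have phi: "phi z = ln L"
    by (simp add: phi_def r_def)
  have ln_lip: "ln x - ln y \<le> x - y" if "1 \<le> y" "y \<le> x" for x y :: real
  proof -
    have "ln x - ln y = ln (x / y)" using that by (simp add: ln_div)
    also have "\<dots> \<le> x / y - 1" using that by (intro ln_le_minus_one) auto
    also have "\<dots> = (x - y) / y" using that by (simp add: field_simps)
    also have "\<dots> \<le> x - y" using that by (simp add: divide_le_eq mult_le_cancel_left1)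
    finally show ?thesis .
  qed
  have "\<bar>ln L - ln (r n)\<bar> \<le> hi - lo"
  proof (cases "L \<le> r n")
    case True
    then show ?thesis
      using ln_lip[of L "r n"] n \<open>lo \<le> L\<close> \<open>L \<le> hi\<close> h(1) ln_mono[of L "r n"] by auto
  next
    case False
    then show ?thesis
      using ln_lip[of "r n" L] n \<open>lo \<le> L\<close> \<open>L \<le> hi\<close> h(1) ln_mono[of "r n" L] by auto
  qed
  then show ?thesis by (simp add: phi h(2) r_def)
qed

text \<open>Each power occurs at most twice, which doubles the geometric sum 72.\<close>

lemma sum_half_geometric: "(\<Sum>i<n. (71/72::real)^(i div 2)) \<le> 144"
proof -
  have "(\<Sum>i<n. (71/72::real)^(i div 2)) \<le> (\<Sum>i<2*n. (71/72)^(i div 2))"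
    by (intro sum_mono2) auto
  also have "\<dots> = 2 * (\<Sum>i<n. (71/72)^i)"
    by (induction n) auto
  also have "(\<Sum>i<n. (71/72::real)^i) = (1 - (71/72)^n) / (1 - 71/72)"
    by (subst sum_gp_strict) simp
  also have "\<dots> \<le> 72" by simp
  finally show ?thesis by simp
qed

text \<open>Stopping the quotient for the \<open>j\<close>th shift at time \<open>n\<close> gives
  the increment \<open>W j - W (Suc j)\<close>, and these telescope. The error decays with the
  remaining length \<open>n - j\<close>, so the total error is bounded.\<close>

lemma birkhoff_sum_phi_approx:
  assumes \<omega>: "\<And>i. \<omega> i \<in> digB"
  shows "\<bar>(\<Sum>j<n. phi (shiftn j \<omega>)) - ln (wordval (map \<omega> [0..<n]))\<bar> \<le> 144"
proof -
  define W where "W j = ln (wordval (map \<omega> [j..<n]))" for j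
  have "\<bar>phi (shiftn j \<omega>) - (W j - W (Suc j))\<bar> \<le> (71/72)^((n - 1 - j) div 2)" if "j < n" for j
  proof -
    have 1: "map (shiftn j \<omega>) [0..<n - j] = map \<omega> [j..<n]"
      "map (shiftn j \<omega>) [1..<n - j] = map \<omega> [Suc j..<n]"
      by (rule nth_equalityI; simp add: shiftn_def add.commute)+
    have "wordval (map \<omega> [j..<n]) > 0" "wordval (map \<omega> [Suc j..<n]) > 0"
      using \<omega> by (auto intro!: wordval_pos)
    then have "ln (wordval (map \<omega> [j..<n]) / wordval (map \<omega> [Suc j..<n])) = W j - W (Suc j)"
      by (simp add: W_def ln_div)
    moreover have "shiftn j \<omega> i \<in> digB" for i using \<omega> by (simp add: shiftn_def)
    ultimately show ?thesis
      using phi_approx[of "shiftn j \<omega>" "n - j"] that unfolding 1 by simp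
  qed
  then have "(\<Sum>j<n. \<bar>phi (shiftn j \<omega>) - (W j - W (Suc j))\<bar>) \<le> (\<Sum>j<n. (71/72)^((n - 1 - j) div 2))"
    by (intro sum_mono) auto
  also have "\<dots> = (\<Sum>i<n. (71/72)^(i div 2))"
    by (intro sum.reindex_bij_witness[of _ "\<lambda>i. n - 1 - i" "\<lambda>i. n - 1 - i"]) auto
  also have "\<dots> \<le> 144" by (rule sum_half_geometric)
  finally have "\<bar>\<Sum>j<n. phi (shiftn j \<omega>) - (W j - W (Suc j))\<bar> \<le> 144"
    using sum_abs order_trans by fast
  moreover have "(\<Sum>j<n. W j - W (Suc j)) = W 0 - W n"
    by (rule sum_lessThan_telescope')
  moreover have "W n = 0" by (simp add: W_def wordval_def)
  ultimately show ?thesis by (simp add: sum_subtractf W_def)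
qed

section \<open>Counting collisions\<close>

definition lists_over :: "'a set \<Rightarrow> nat \<Rightarrow> 'a list set" where
  "lists_over D n = {w. set w \<subseteq> D \<and> length w = n}"

lemma finite_lists_over [simp]: "finite D \<Longrightarrow> finite (lists_over D n)"
  by (simp add: lists_over_def finite_lists_length_eq)

lemma lists_over_0 [simp]: "lists_over D 0 = {[]}"
  by (auto simp: lists_over_def)

lemma lists_over_Suc: "lists_over D (Suc n) = (\<lambda>(w, d). w @ [d]) ` (lists_over D n \<times> D)"
proof (intro equalityI subsetI)
  fix w assume "w \<in> lists_over D (Suc n)"
  then show "w \<in> (\<lambda>(w, d). w @ [d]) ` (lists_over D n \<times> D)"
    by (cases w rule: rev_cases) (auto simp: lists_over_def image_iff)
qed (auto simp: lists_over_def)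

lemma sum_lists_over_Suc:
  "(\<Sum>w\<in>lists_over D (Suc n). f w) = (\<Sum>w\<in>lists_over D n. \<Sum>d\<in>D. f (w @ [d]))"
  unfolding lists_over_Suc
  by (subst sum.reindex) (auto simp: inj_on_def sum.cartesian_product case_prod_unfold)

lemma card_lists_over: "finite D \<Longrightarrow> card (lists_over D n) = card D ^ n"
  by (simp add: lists_over_def card_lists_length_eq)

lemma append_lists_over: "a \<in> lists_over D m \<Longrightarrow> b \<in> lists_over D n \<Longrightarrow> a @ b \<in> lists_over D (m + n)"
  by (auto simp: lists_over_def)

definition dig3 :: "(nat \<times> nat) set" where
  "dig3 = {(0,0),(1,0),(0,1)}"

lemma finite_dig3 [simp]: "finite dig3"
  by (simp add: dig3_def)

lemma card_dig3: "card dig3 = 3"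
  by (simp add: dig3_def)

lemma finite_digB [simp]: "finite digB"
  by (simp add: digB_def)

text \<open>Horner's scheme with the leading digit first: the dyadic value of the word times 2 to
  the power of its length. Congruences modulo 1 become divisibility.\<close>

definition hval :: "('a \<Rightarrow> int) \<Rightarrow> 'a list \<Rightarrow> int" where
  "hval f = foldl (\<lambda>s d. 2 * s + f d) 0"

lemma hval_Nil [simp]: "hval f [] = 0"
  by (simp add: hval_def)

lemma hval_snoc [simp]: "hval f (w @ [d]) = 2 * hval f w + f d"
  by (simp add: hval_def)

lemma hval_append: "hval f (v @ w) = 2 ^ length w * hval f v + hval f w"
  by (induction w rule: rev_induct) (simp_all flip: append_assoc add: algebra_simps)

section \<open>Pairs of gasket words over a dyadic square\<close>

abbreviation hx :: "(nat \<times> nat) list \<Rightarrow> int" where "hx \<equiv> hval (\<lambda>d. int (fst d))"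
abbreviation hy :: "(nat \<times> nat) list \<Rightarrow> int" where "hy \<equiv> hval (\<lambda>d. int (snd d))"

text \<open>Congruence of the difference of two points of the gasket to a corner of a dyadic square;
  reversing the sign of the second coordinate turns the projection into the line of slope \<open>p/q\<close>.\<close>
definition hit :: "int \<Rightarrow> int \<Rightarrow> (nat \<times> nat) list \<Rightarrow> (nat \<times> nat) list \<Rightarrow> bool" where
  "hit x y a b \<longleftrightarrow> 2 ^ length a dvd hx a - hx b - x \<and> 2 ^ length a dvd hy b - hy a - y"

text \<open>These are the offsets, from -3 to 1, that two gasket digits, a digit of the square and a
  corner can produce. Parity excludes the odd ones; the even ones are halved.\<close>

lemma double_dvd_shift:
  fixes N X :: int
  shows "2 * N dvd 2 * X + 1 \<longleftrightarrow> False" "2 * N dvd 2 * X - 1 \<longleftrightarrow> False" "2 * N dvd 2 * X - 3 \<longleftrightarrow> False"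
    "2 * N dvd 2 * X \<longleftrightarrow> N dvd X" "2 * N dvd 2 * X - 2 \<longleftrightarrow> N dvd X - 1"
proof -
  have odd: "\<not> 2 * N dvd z" if "odd z" for z using that by (meson dvd_mult_left)
  show "2 * N dvd 2 * X + 1 \<longleftrightarrow> False" "2 * N dvd 2 * X - 1 \<longleftrightarrow> False" "2 * N dvd 2 * X - 3 \<longleftrightarrow> False"
    by (simp_all add: odd)
  show "2 * N dvd 2 * X \<longleftrightarrow> N dvd X" by simp
  have "2 * X - 2 = 2 * (X - 1)" by simp
  then show "2 * N dvd 2 * X - 2 \<longleftrightarrow> N dvd X - 1" by (simp only: dvd_mult_cancel_left) simp
qed

lemma sum_dig3: "(\<Sum>e\<in>dig3. F e) = F (0,0) + F (1,0) + F (0,1)"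
  by (simp add: dig3_def add.assoc)

lemma sum_lessThan_4: "(\<Sum>i<4::nat. F i) = F 0 + F 1 + F 2 + F 3"
  by (simp add: lessThan_4 add.assoc)

text \<open>The meaning of the matrices: corner \<open>i\<close> has coordinates
  \<open>i mod 2\<close> and \<open>i div 2\<close>, and \<open>Amat d i c\<close> is the number of
  pairs \<open>e\<close>, \<open>f\<close> with
  \<open>fst e - fst f = fst d + c mod 2 - 2 * (i mod 2)\<close> and the analogous equation for
  \<open>snd f - snd e\<close>.\<close>

lemma Amat_counts:
  fixes N X Y :: int
  assumes "d \<in> digB" "c < 4"
  shows "(\<Sum>i<4. of_bool (N dvd X - int (i mod 2) \<and> N dvd Y - int (i div 2)) * Amat d i c) =
    (\<Sum>e\<in>dig3. \<Sum>f\<in>dig3. of_bool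
      (2 * N dvd 2 * X + (int (fst e) - int (fst f) - int (fst d) - int (c mod 2)) \<and>
       2 * N dvd 2 * Y + (int (snd f) - int (snd e) - int (snd d) - int (c div 2))))"
proof -
  have "\<forall>c<4. (\<Sum>i<4. of_bool (N dvd X - int (i mod 2) \<and> N dvd Y - int (i div 2)) * Amat d i c) =
    (\<Sum>e\<in>dig3. \<Sum>f\<in>dig3. of_bool
      (2 * N dvd 2 * X + (int (fst e) - int (fst f) - int (fst d) - int (c mod 2)) \<and>
       2 * N dvd 2 * Y + (int (snd f) - int (snd e) - int (snd d) - int (c div 2))))"
    unfolding all_less_4 sum_dig3 sum_lessThan_4
    by (rule digBE[OF assms(1)]; simp add: Amat_def double_dvd_shift)
  then show ?thesis using assms(2) by blast
qed

text \<open>Induction on the last digit, with \<open>Amat_counts\<close> as the inductive step. The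
  all-ones vector fits the empty word because every congruence modulo 1 holds.\<close>

lemma vvec_eq_count:
  assumes "set w \<subseteq> digB" "c < 4"
  shows "vvec w c = (\<Sum>a\<in>lists_over dig3 (length w). \<Sum>b\<in>lists_over dig3 (length w).
    of_bool (hit (hx w + int (c mod 2)) (hy w + int (c div 2)) a b))"
  using assms
proof (induction w arbitrary: c rule: rev_induct)
  case Nil
  then show ?case by (simp add: hit_def)
next
  case (snoc d w)
  let ?L = "lists_over dig3 (length w)"
  define X where "X a b = hx a - hx b - hx w" for a b
  define Y where "Y a b = hy b - hy a - hy w" for a b
  define N :: int where "N = 2 ^ length w"
  have len: "length a = length w" if "a \<in> ?L" for a using that by (simp add: lists_over_def)
  have IH: "vvec w i = (\<Sum>a\<in>?L. \<Sum>b\<in>?L. of_bool (N dvd X a b - int (i mod 2) \<and> N dvd Y a b - int (i div 2)))"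
    if "i < 4" for i
  proof -
    have "vvec w i = (\<Sum>a\<in>?L. \<Sum>b\<in>?L. of_bool (hit (hx w + int (i mod 2)) (hy w + int (i div 2)) a b))"
      using snoc that by simp
    also have "\<dots> = (\<Sum>a\<in>?L. \<Sum>b\<in>?L. of_bool (N dvd X a b - int (i mod 2) \<and> N dvd Y a b - int (i div 2)))"
      by (intro sum.cong refl) (simp add: hit_def len X_def Y_def N_def algebra_simps)
    finally show ?thesis .
  qed
  have "vvec (w @ [d]) c = (\<Sum>i<4. vvec w i * Amat d i c)"
    by (simp add: vvec_snoc vecmat_def)
  also have "\<dots> = (\<Sum>i<4. \<Sum>a\<in>?L. \<Sum>b\<in>?L.
      of_bool (N dvd X a b - int (i mod 2) \<and> N dvd Y a b - int (i div 2)) * Amat d i c)"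
    by (intro sum.cong refl) (simp add: IH sum_distrib_right)
  also have "\<dots> = (\<Sum>a\<in>?L. \<Sum>i<4. \<Sum>b\<in>?L.
      of_bool (N dvd X a b - int (i mod 2) \<and> N dvd Y a b - int (i div 2)) * Amat d i c)"
    by (rule sum.swap)
  also have "\<dots> = (\<Sum>a\<in>?L. \<Sum>b\<in>?L. \<Sum>i<4.
      of_bool (N dvd X a b - int (i mod 2) \<and> N dvd Y a b - int (i div 2)) * Amat d i c)"
    by (intro sum.cong refl sum.swap)
  also have "\<dots> = (\<Sum>a\<in>?L. \<Sum>b\<in>?L. \<Sum>e\<in>dig3. \<Sum>f\<in>dig3. of_bool
      (2 * N dvd 2 * X a b + (int (fst e) - int (fst f) - int (fst d) - int (c mod 2)) \<and>
       2 * N dvd 2 * Y a b + (int (snd f) - int (snd e) - int (snd d) - int (c div 2))))"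
    using snoc.prems by (intro sum.cong refl Amat_counts) auto
  also have "\<dots> = (\<Sum>a\<in>?L. \<Sum>b\<in>?L. \<Sum>e\<in>dig3. \<Sum>f\<in>dig3. of_bool
      (hit (hx (w @ [d]) + int (c mod 2)) (hy (w @ [d]) + int (c div 2)) (a @ [e]) (b @ [f])))"
    by (intro sum.cong refl arg_cong[of _ _ of_bool])
      (simp add: hit_def len X_def Y_def N_def algebra_simps)
  also have "\<dots> = (\<Sum>a\<in>?L. \<Sum>e\<in>dig3. \<Sum>b\<in>?L. \<Sum>f\<in>dig3. of_bool
      (hit (hx (w @ [d]) + int (c mod 2)) (hy (w @ [d]) + int (c div 2)) (a @ [e]) (b @ [f])))"
    by (intro sum.cong refl sum.swap)
  finally show ?case by (simp add: sum_lists_over_Suc)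
qed

text \<open>Binary expansion of residues, the last digit being the parity. Hence every pair of
  gasket words hits exactly one dyadic square at its corner 0.\<close>

lemma binary_word_unique:
  "\<exists>!w. w \<in> lists_over digB n \<and> 2 ^ n dvd x - hx w \<and> 2 ^ n dvd y - hy w"
proof (induction n arbitrary: x y)
  case 0
  show ?case by auto
next
  case (Suc n)
  let ?P = "\<lambda>n x y w. w \<in> lists_over digB n \<and> 2 ^ n dvd x - hx w \<and> 2 ^ n dvd y - hy w"
  have step: "?P (Suc n) x y (w @ [d]) \<longleftrightarrow> ?P n (x div 2) (y div 2) w \<and> d = (nat (x mod 2), nat (y mod 2))"
    for w d
  proof -
    have dv: "2 ^ Suc n dvd z - (2 * s + int e) \<longleftrightarrow> 2 ^ n dvd z div 2 - s \<and> e = nat (z mod 2)"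
      if "e < 2" for z s :: int and e
    proof -
      have z: "2 * (z div 2) + z mod 2 = z" by simp
      define T where "T = z div 2 - s"
      have eq: "z - (2 * s + int e) = 2 * T + (z mod 2 - int e)"
        using z unfolding T_def by presburger
      have "z mod 2 = 0 \<or> z mod 2 = 1" "e = 0 \<or> e = 1" using that by auto
      then consider "z mod 2 = 0" "e = 0" | "z mod 2 = 0" "e = 1" | "z mod 2 = 1" "e = 0" | "z mod 2 = 1" "e = 1"
        by blast
      then show ?thesis
        unfolding eq T_def[symmetric] power_Suc by cases (simp_all add: double_dvd_shift)
    qed
    show ?thesis
    proof (cases "d \<in> digB")
      case True
      then have "fst d < 2" "snd d < 2" by (auto simp: digB_def)
      then show ?thesis
        using True dv[of "fst d" x "hx w"] dv[of "snd d" y "hy w"]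
        by (auto simp: lists_over_def prod_eq_iff)
    next
      case False
      moreover have "(nat (x mod 2), nat (y mod 2)) \<in> digB"
        by (auto simp: digB_def)
      ultimately show ?thesis by (auto simp: lists_over_def)
    qed
  qed
  obtain w where w: "?P n (x div 2) (y div 2) w" "\<And>v. ?P n (x div 2) (y div 2) v \<Longrightarrow> v = w"
    using Suc.IH[of "x div 2" "y div 2"] by blast
  show ?case
  proof (rule ex1I[of _ "w @ [(nat (x mod 2), nat (y mod 2))]"])
    show "?P (Suc n) x y (w @ [(nat (x mod 2), nat (y mod 2))])"
      using w(1) unfolding step by simp
    fix v assume v: "?P (Suc n) x y v"
    then obtain u d where "v = u @ [d]"
      by (auto simp: lists_over_Suc)
    then show "v = w @ [(nat (x mod 2), nat (y mod 2))]"
      using v w(2) step by blast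
  qed
qed

section \<open>Dyadic points on the extended line\<close>

lemma sum_eq_hval: "(\<Sum>i<length w. real (f (w ! i)) / 2 ^ (i+1)) = hval (\<lambda>d. int (f d)) w / 2 ^ length w"
proof (induction w rule: rev_induct)
  case (snoc d w)
  then show ?case by (simp add: nth_append field_simps)
qed simp

text \<open>Since \<open>p\<close> and \<open>q\<close> are coprime, integer translations change
  \<open>q * y - p * x\<close> by arbitrary integers; so a point (x, y) lies on the extended line
  iff this number is an integer.\<close>

lemma piw_in_lpq_iff:
  assumes "coprime p q" "0 < q"
  shows "piw w \<in> lpq p q \<longleftrightarrow> 2 ^ length w dvd int q * hy w - int p * hx w"
proof -
  define n where "n = length w"
  have piw: "piw w = (hx w / 2 ^ n, hy w / 2 ^ n)"
    by (simp add: piw_def sum_eq_hval n_def del: One_nat_def)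
  show ?thesis
  proof
    assume "piw w \<in> lpq p q"
    then obtain x' y' where *: "hx w / 2 ^ n - x' \<in> \<int>" "hy w / 2 ^ n - y' \<in> \<int>" "real p / real q * x' = y'"
      by (auto simp: lpq_def piw)
    then obtain i j where ij: "hx w / 2 ^ n - x' = of_int i" "hy w / 2 ^ n - y' = of_int j"
      by (auto elim!: Ints_cases)
    have "real q * y' = real p * x'" using *(3) assms(2) by (auto simp: field_simps)
    moreover have "x' = hx w / 2 ^ n - of_int i" "y' = hy w / 2 ^ n - of_int j" using ij by auto
    ultimately have "real_of_int (int q * hy w - int p * hx w) = of_int (2 ^ n * (int q * j - int p * i))"
      by (simp add: field_simps)
    then have "int q * hy w - int p * hx w = 2 ^ n * (int q * j - int p * i)"
      by (simp only: of_int_eq_iff)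
    then show "2 ^ length w dvd int q * hy w - int p * hx w" by (simp add: n_def)
  next
    assume "2 ^ length w dvd int q * hy w - int p * hx w"
    then obtain k where k: "int q * hy w - int p * hx w = 2 ^ n * k" by (auto simp: n_def)
    \<comment> \<open>Bezout coefficients scaled by \<open>k\<close> give the integer translation
      onto the line.\<close>
    obtain u v where uv: "u * int p + v * int q = 1"
      using assms(1) bezout_int[of "int p" "int q"] by auto
    define x' where "x' = hx w / 2 ^ n + of_int (k * u)"
    define y' where "y' = hy w / 2 ^ n - of_int (k * v)"
    have "real_of_int (int q * hy w - int p * hx w) = of_int (2 ^ n * k)"
      by (simp only: k)
    then have "q * (hy w / 2 ^ n) - p * (hx w / 2 ^ n) = of_int k" by (simp add: field_simps)
    moreover have "of_int k = of_int k * real_of_int (u * int p + v * int q)" by (simp add: uv)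
    ultimately have "q * y' = p * x'" by (simp add: x'_def y'_def algebra_simps)
    then have "real p / real q * x' = y'" using assms(2) by (simp add: field_simps)
    moreover have "hx w / 2 ^ n - x' \<in> \<int>" "hy w / 2 ^ n - y' \<in> \<int>"
      unfolding x'_def y'_def by auto
    ultimately show "piw w \<in> lpq p q" unfolding piw lpq_def by blast
  qed
qed

text \<open>\<open>q * 2 ^ n\<close> times the dyadic sum of a word of length \<open>n\<close> over
  0, 1, p/q, where (0,1) encodes the digit 1 and (1,0) the digit p/q.\<close>

definition tval :: "nat \<Rightarrow> nat \<Rightarrow> (nat \<times> nat) list \<Rightarrow> int" where
  "tval p q = hval (\<lambda>d. int q * int (snd d) + int p * int (fst d))"

lemma tval_eq: "tval p q w = int q * hy w + int p * hx w"
  by (induction w rule: rev_induct) (simp_all add: tval_def algebra_simps)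

lemma Xn_eq:
  assumes "coprime p q" "0 < q"
  shows "Xn p q n = {w \<in> lists_over digB n. 2 ^ n dvd int q * hy w - int p * hx w}"
  using piw_in_lpq_iff[OF assms] by (auto simp: Xn_def lists_over_def)

text \<open>After exchanging the sums, each pair \<open>(a, b)\<close> is counted by the single
  square that it hits, and the corner of that square is on the line iff the projections agree modulo
  \<open>2 ^ n\<close>.\<close>

lemma sum_wordval_Xn:
  assumes "coprime p q" "0 < q"
  shows "(\<Sum>w\<in>Xn p q n. wordval w) =
    real (card {(a, b) \<in> lists_over dig3 n \<times> lists_over dig3 n. 2 ^ n dvd tval p q a - tval p q b})"
proof -
  let ?L = "lists_over dig3 n"
  have Xn: "finite (Xn p q n)" by (simp add: Xn_eq[OF assms])
  have "(\<Sum>w\<in>Xn p q n. wordval w) = (\<Sum>w\<in>Xn p q n. \<Sum>a\<in>?L. \<Sum>b\<in>?L. of_bool (hit (hx w) (hy w) a b))"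
    by (intro sum.cong refl) (auto simp: wordval_eq_vvec vvec_eq_count Xn_def)
  also have "\<dots> = (\<Sum>a\<in>?L. \<Sum>w\<in>Xn p q n. \<Sum>b\<in>?L. of_bool (hit (hx w) (hy w) a b))"
    by (rule sum.swap)
  also have "\<dots> = (\<Sum>a\<in>?L. \<Sum>b\<in>?L. \<Sum>w\<in>Xn p q n. of_bool (hit (hx w) (hy w) a b))"
    by (intro sum.cong refl sum.swap)
  also have "\<dots> = (\<Sum>a\<in>?L. \<Sum>b\<in>?L. of_bool (2 ^ n dvd tval p q a - tval p q b))"
  proof (intro sum.cong refl)
    fix a b assume ab: "a \<in> ?L" "b \<in> ?L"
    then have [simp]: "length a = n" by (simp add: lists_over_def)
    obtain w where w: "w \<in> lists_over digB n" "2 ^ n dvd hx a - hx b - hx w" "2 ^ n dvd hy b - hy a - hy w"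
      and uniq: "\<And>v. v \<in> lists_over digB n \<Longrightarrow> 2 ^ n dvd hx a - hx b - hx v \<Longrightarrow> 2 ^ n dvd hy b - hy a - hy v \<Longrightarrow> v = w"
      using binary_word_unique[of n "hx a - hx b" "hy b - hy a"] by blast
    have "(\<Sum>v\<in>Xn p q n. of_bool (hit (hx v) (hy v) a b)) = (\<Sum>v\<in>Xn p q n. if v = w then 1 else 0 :: real)"
    proof (intro sum.cong refl)
      fix v assume "v \<in> Xn p q n"
      then have "v \<in> lists_over digB n" by (simp add: Xn_eq[OF assms])
      then have "hit (hx v) (hy v) a b \<longleftrightarrow> v = w"
        using w(2,3) uniq[of v] unfolding hit_def \<open>length a = n\<close> by blast
      then show "of_bool (hit (hx v) (hy v) a b) = (if v = w then 1 else 0 :: real)" by simp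
    qed
    also have "\<dots> = of_bool (w \<in> Xn p q n)" using Xn by simp
    also have "w \<in> Xn p q n \<longleftrightarrow> 2 ^ n dvd int q * hy w - int p * hx w"
      using w by (simp add: Xn_eq[OF assms])
    also have "\<dots> \<longleftrightarrow> 2 ^ n dvd tval p q a - tval p q b"
    proof -
      \<comment> \<open>The reversed second coordinate in \<open>hit\<close> turns
        \<open>q * y - p * x\<close> into minus the difference of the projections, up to multiples
        of \<open>2 ^ n\<close>.\<close>
      have "int q * hy w - int p * hx w =
         - (tval p q a - tval p q b) - (int q * (hy b - hy a - hy w) - int p * (hx a - hx b - hx w))"
        by (simp add: tval_eq algebra_simps)
      moreover have "2 ^ n dvd int q * (hy b - hy a - hy w) - int p * (hx a - hx b - hx w)"
        by (rule dvd_diff[OF dvd_mult[OF w(3)] dvd_mult[OF w(2)]])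
      ultimately show ?thesis by (metis dvd_diff_left_iff dvd_minus_iff)
    qed
    finally show "(\<Sum>v\<in>Xn p q n. of_bool (hit (hx v) (hy v) a b) :: real) = of_bool (2 ^ n dvd tval p q a - tval p q b)" .
  qed
  also have "\<dots> = (\<Sum>(a, b)\<in>?L \<times> ?L. of_bool (2 ^ n dvd tval p q a - tval p q b))"
    by (rule sum.cartesian_product)
  also have "\<dots> = real (card {(a, b) \<in> ?L \<times> ?L. 2 ^ n dvd tval p q a - tval p q b})"
    by (simp add: case_prod_unfold sum_of_bool_eq Int_def mem_Times_iff conj_assoc)
  finally show ?thesis .
qed

section \<open>Collision numbers\<close>

lemma card_diff_eq:
  fixes f :: "'a \<Rightarrow> int"
  assumes "finite L"
  shows "card {(a, b) \<in> L \<times> L. f a - f b = k} =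
    (\<Sum>v\<in>f ` L. card {a \<in> L. f a = v + k} * card {a \<in> L. f a = v})"
proof -
  have "{(a, b) \<in> L \<times> L. f a - f b = k} = prod.swap ` (SIGMA b:L. {a \<in> L. f a = f b + k})"
    by force
  then have "card {(a, b) \<in> L \<times> L. f a - f b = k} = card (SIGMA b:L. {a \<in> L. f a = f b + k})"
    by (simp add: card_image)
  also have "\<dots> = (\<Sum>b\<in>L. card {a \<in> L. f a = f b + k})"
    using assms by (intro card_SigmaI) auto
  also have "\<dots> = (\<Sum>v\<in>f ` L. \<Sum>b | b \<in> L \<and> f b = v. card {a \<in> L. f a = f b + k})"
    by (rule sum.image_gen[OF assms])
  also have "\<dots> = (\<Sum>v\<in>f ` L. \<Sum>b | b \<in> L \<and> f b = v. card {a \<in> L. f a = v + k})"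
    by (intro sum.cong refl) auto
  finally show ?thesis by (simp add: mult.commute)
qed

text \<open>The autocorrelation of the fibre sizes is largest at shift 0, by
  \<open>2 * x * y \<le> x\<^sup>2 + y\<^sup>2\<close>.\<close>

lemma card_diff_le:
  fixes f :: "'a \<Rightarrow> int"
  assumes L: "finite L"
  shows "card {(a, b) \<in> L \<times> L. f a - f b = k} \<le> card {(a, b) \<in> L \<times> L. f a = f b}"
proof -
  define c where "c v = card {a \<in> L. f a = v}" for v
  have M: "card {(a, b) \<in> L \<times> L. f a = f b} = (\<Sum>v\<in>f ` L. (c v)\<^sup>2)"
    using card_diff_eq[OF L, of f 0] by (simp add: c_def power2_eq_square)
  have "(\<Sum>v\<in>f ` L. (c (v + k))\<^sup>2) = (\<Sum>v\<in>(\<lambda>v. v + k) ` f ` L. (c v)\<^sup>2)"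
    by (subst sum.reindex) (auto simp: inj_on_def)
  also have "\<dots> = (\<Sum>v\<in>((\<lambda>v. v + k) ` f ` L) \<inter> f ` L. (c v)\<^sup>2)"
    using L by (intro sum.mono_neutral_right) (auto simp: c_def card_eq_0_iff, metis imageI)
  also have "\<dots> \<le> (\<Sum>v\<in>f ` L. (c v)\<^sup>2)"
    using L by (intro sum_mono2) auto
  finally have shifted: "(\<Sum>v\<in>f ` L. (c (v + k))\<^sup>2) \<le> (\<Sum>v\<in>f ` L. (c v)\<^sup>2)" .
  have "2 * card {(a, b) \<in> L \<times> L. f a - f b = k} = (\<Sum>v\<in>f ` L. 2 * (c (v + k) * c v))"
    unfolding card_diff_eq[OF L] c_def sum_distrib_left ..
  also have "\<dots> \<le> (\<Sum>v\<in>f ` L. (c (v + k))\<^sup>2 + (c v)\<^sup>2)"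
  proof (intro sum_mono)
    fix v
    have "real (2 * (c (v + k) * c v)) \<le> real ((c (v + k))\<^sup>2 + (c v)\<^sup>2)"
      using sum_squares_bound[of "real (c (v + k))" "real (c v)"] by simp
    then show "2 * (c (v + k) * c v) \<le> (c (v + k))\<^sup>2 + (c v)\<^sup>2" by (simp only: of_nat_le_iff)
  qed
  also have "\<dots> \<le> 2 * (\<Sum>v\<in>f ` L. (c v)\<^sup>2)"
    using shifted by (simp add: sum.distrib)
  finally show ?thesis using M by simp
qed

text \<open>Divided by \<open>9 ^ n\<close>, this is the probability that two independent uniform
  words have the same sum.\<close>

definition collisions :: "nat \<Rightarrow> nat \<Rightarrow> nat \<Rightarrow> nat" where
  "collisions p q n = card {(a, b) \<in> lists_over dig3 n \<times> lists_over dig3 n. tval p q a = tval p q b}"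

lemma tval_bounds:
  assumes "p \<le> q" "a \<in> lists_over dig3 n"
  shows "0 \<le> tval p q a" "tval p q a \<le> int q * (2 ^ n - 1)"
proof -
  have "0 \<le> tval p q a \<and> tval p q a \<le> int q * (2 ^ length a - 1)" if "set a \<subseteq> dig3"
    using that
  proof (induction a rule: rev_induct)
    case (snoc d a)
    then have "int q * int (snd d) + int p * int (fst d) \<le> int q"
      using assms(1) by (auto simp: dig3_def)
    with snoc show ?case by (auto simp: tval_def algebra_simps)
  qed (simp add: tval_def)
  then show "0 \<le> tval p q a" "tval p q a \<le> int q * (2 ^ n - 1)"
    using assms(2) by (auto simp: lists_over_def)
qed

lemma sum_wordval_Xn_ge:
  assumes "coprime p q" "0 < q"
  shows "real (collisions p q n) \<le> (\<Sum>w\<in>Xn p q n. wordval w)"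
  unfolding sum_wordval_Xn[OF assms] collisions_def of_nat_le_iff
  by (rule card_mono) (auto intro: finite_subset[of _ "lists_over dig3 n \<times> lists_over dig3 n"])

text \<open>Projections lie between 0 and \<open>q * (2 ^ n - 1)\<close>, so a difference divisible
  by \<open>2 ^ n\<close> is one of \<open>2 * q + 1\<close> multiples, and no shift has more pairs
  than shift 0.\<close>

lemma sum_wordval_Xn_le:
  assumes "coprime p q" "0 < q" "p \<le> q"
  shows "(\<Sum>w\<in>Xn p q n. wordval w) \<le> real (2 * q + 1) * real (collisions p q n)"
proof -
  let ?L = "lists_over dig3 n"
  have "{(a, b) \<in> ?L \<times> ?L. 2 ^ n dvd tval p q a - tval p q b}
    \<subseteq> (\<Union>k\<in>{- int q..int q}. {(a, b) \<in> ?L \<times> ?L. tval p q a - tval p q b = 2 ^ n * k})"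
  proof clarify
    fix a b assume ab: "a \<in> ?L" "b \<in> ?L" "2 ^ n dvd tval p q a - tval p q b"
    then obtain k where k: "tval p q a - tval p q b = 2 ^ n * k" by auto
    have "int q * (2 ^ n - 1) \<le> 2 ^ n * int q" by (simp add: algebra_simps)
    then have "2 ^ n * k \<le> 2 ^ n * int q" "2 ^ n * - int q \<le> 2 ^ n * k"
      using tval_bounds[OF assms(3) ab(1)] tval_bounds[OF assms(3) ab(2)] k by linarith+
    then have "k \<in> {- int q..int q}" by (simp only: mult_le_cancel_left_pos zero_less_power) simp
    then show "(a, b) \<in> (\<Union>k\<in>{- int q..int q}. {(a, b) \<in> ?L \<times> ?L. tval p q a - tval p q b = 2 ^ n * k})"
      using ab k by blast
  qed
  then have "card {(a, b) \<in> ?L \<times> ?L. 2 ^ n dvd tval p q a - tval p q b}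
    \<le> card (\<Union>k\<in>{- int q..int q}. {(a, b) \<in> ?L \<times> ?L. tval p q a - tval p q b = 2 ^ n * k})"
    by (intro card_mono) (auto intro: finite_subset[of _ "?L \<times> ?L"])
  also have "\<dots> \<le> (\<Sum>k\<in>{- int q..int q}. card {(a, b) \<in> ?L \<times> ?L. tval p q a - tval p q b = 2 ^ n * k})"
    by (rule card_UN_le) simp
  also have "\<dots> \<le> (\<Sum>k\<in>{- int q..int q}. collisions p q n)"
    unfolding collisions_def by (intro sum_mono card_diff_le) simp
  also have "\<dots> = card {- int q..int q} * collisions p q n" by simp
  also have "card {- int q..int q} = 2 * q + 1"
    unfolding card_atLeastAtMost_int by arith
  finally show ?thesis
    unfolding sum_wordval_Xn[OF assms(1,2)] of_nat_mult[symmetric] of_nat_le_iff .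
qed

lemma collisions_pos: "0 < collisions p q n"
proof -
  have "(replicate n (0,0), replicate n (0,0)) \<in>
      {(a, b) \<in> lists_over dig3 n \<times> lists_over dig3 n. tval p q a = tval p q b}"
    by (auto simp: lists_over_def dig3_def)
  then show ?thesis
    unfolding collisions_def card_gt_0_iff
    by (auto intro: finite_subset[of _ "lists_over dig3 n \<times> lists_over dig3 n"])
qed

lemma collisions_le: "collisions p q n \<le> 9 ^ n"
proof -
  have "collisions p q n \<le> card (lists_over dig3 n \<times> lists_over dig3 n)"
    unfolding collisions_def by (intro card_mono) auto
  also have "\<dots> = 9 ^ n"
    by (simp add: card_cartesian_product card_lists_over card_dig3 flip: power_mult_distrib)
  finally show ?thesis .
qed

text \<open>Concatenating colliding pairs is injective and yields colliding pairs.\<close>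

lemma collisions_supermult: "collisions p q m * collisions p q n \<le> collisions p q (m + n)"
proof -
  let ?C = "\<lambda>n. {(a, b) \<in> lists_over dig3 n \<times> lists_over dig3 n. tval p q a = tval p q b}"
  have "card (?C m \<times> ?C n) \<le> card (?C (m + n))"
  proof (rule card_inj_on_le[of "\<lambda>((a, b), (a', b')). (a @ a', b @ b')"])
    show "inj_on (\<lambda>((a, b), (a', b')). (a @ a', b @ b')) (?C m \<times> ?C n)"
      by (auto simp: inj_on_def lists_over_def)
    show "(\<lambda>((a, b), (a', b')). (a @ a', b @ b')) ` (?C m \<times> ?C n) \<subseteq> ?C (m + n)"
      by (auto intro: append_lists_over simp: tval_def hval_append) (auto simp: lists_over_def)
    show "finite (?C (m + n))"
      by (auto intro: finite_subset[of _ "lists_over dig3 (m + n) \<times> lists_over dig3 (m + n)"])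
  qed
  then show ?thesis by (simp add: collisions_def card_cartesian_product)
qed

text \<open>Fekete's lemma; the limit is the supremum of the quotients. As \<open>u\<close> is
  nonnegative, the remainder of \<open>n\<close> modulo \<open>m\<close> can simply be
  dropped.\<close>

lemma fekete_superadditive:
  fixes u :: "nat \<Rightarrow> real"
  assumes nonneg: "\<And>n. 0 \<le> u n" and super: "\<And>m n. u m + u n \<le> u (m + n)"
    and bound: "\<And>n. u n \<le> C * real n"
  shows "convergent (\<lambda>n. u n / real n)"
proof -
  define L where "L = (SUP n\<in>{1..}. u n / real n)"
  have bdd: "bdd_above ((\<lambda>n. u n / real n) ` {1..})"
    using bound by (intro bdd_aboveI[of _ C]) (auto simp: field_simps)
  have mult: "real k * u m \<le> u (k * m)" for k m
  proof (induction k)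
    case (Suc k)
    then show ?case using super[of m "k * m"] by (simp add: algebra_simps)
  qed (use nonneg in simp)
  have "(\<lambda>n. u n / real n) \<longlonglongrightarrow> L"
  proof (rule order_tendstoI)
    fix y assume "L < y"
    have "\<forall>n\<ge>1. u n / real n \<le> L"
      unfolding L_def using cSUP_upper[OF _ bdd] by auto
    then show "\<forall>\<^sub>F n in sequentially. u n / real n < y"
      using \<open>L < y\<close> by (intro eventually_sequentiallyI[of 1]) fastforce
  next
    fix y assume "y < L"
    then obtain m where m: "m \<ge> 1" "y < u m / real m"
      unfolding L_def using less_cSUP_iff[OF _ bdd, of y] by auto
    \<comment> \<open>\<open>n div m\<close> exceeds \<open>n / m - 1\<close>, so the loss against
      \<open>u m / m\<close> is of order \<open>1 / n\<close>.\<close>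
    have le: "u m * (1 / real m - 1 / real n) \<le> u n / real n" if "n \<ge> 1" for n
    proof -
      define k where "k = n div m"
      have "u (k * m) + u (n mod m) \<le> u n" using super[of "k * m" "n mod m"] by (simp add: k_def)
      then have 1: "real k * u m \<le> u n" using mult[of k m] nonneg[of "n mod m"] by linarith
      have "n = k * m + n mod m" "n mod m < m" using m(1) by (simp_all add: k_def)
      then have "n < (k + 1) * m" by (simp add: algebra_simps)
      then have "real n < real ((k + 1) * m)" by (simp only: of_nat_less_iff)
      then have "real n / real m - 1 \<le> real k" using m(1) by (simp add: field_simps)
      then have "(real n / real m - 1) * u m \<le> u n" using mult_right_mono[OF _ nonneg[of m]] 1 by fastforce
      then have "((real n / real m - 1) * u m) / real n \<le> u n / real n" by (intro divide_right_mono) auto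
      moreover have "u m * (1 / real m - 1 / real n) = ((real n / real m - 1) * u m) / real n"
        using that m(1) by (simp add: field_simps)
      ultimately show ?thesis by simp
    qed
    have "(\<lambda>n. u m * (1 / real m - 1 / real n)) \<longlonglongrightarrow> u m * (1 / real m - 0)"
      by (intro tendsto_intros lim_1_over_n)
    then have "\<forall>\<^sub>F n in sequentially. y < u m * (1 / real m - 1 / real n)"
      using m(2) by (intro order_tendstoD) auto
    then show "\<forall>\<^sub>F n in sequentially. y < u n / real n"
      using eventually_ge_at_top[of 1] by eventually_elim (use le in \<open>force intro: less_le_trans\<close>)
  qed
  then show ?thesis by (auto simp: convergent_def)
qed

section \<open>Birkhoff sums on cylinders and existence of the pressure\<close>

lemma cyl_nonempty:
  assumes "w \<in> Xn p q n"
  shows "cyl p q w \<noteq> {}"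
proof -
  \<comment> \<open>Padding with the digit (0,0) keeps the point of the finite word, hence stays on
    the line.\<close>
  define \<omega> where "\<omega> i = (if i < length w then w ! i else (0, 0))" for i
  have w: "set w \<subseteq> digB" "piw w \<in> lpq p q" using assms by (auto simp: Xn_def)
  have "(\<Sum>i. real (f (\<omega> i)) / 2 ^ (i+1)) = (\<Sum>i<length w. real (f (w ! i)) / 2 ^ (i+1))"
    if "f (0, 0) = 0" for f
    by (subst suminf_finite[of "{..<length w}"]) (auto simp: \<omega>_def that)
  then have "pis \<omega> = piw w" by (simp add: pis_def piw_def)
  moreover have "\<omega> i \<in> digB" for i
    using w(1) by (auto simp: \<omega>_def digB_def dest: nth_mem)
  ultimately have "\<omega> \<in> cyl p q w" using w(2) by (auto simp: cyl_def XN_def \<omega>_def)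
  then show ?thesis by blast
qed

text \<open>The estimate for Birkhoff sums sees only the first \<open>n\<close> digits, so it is
  uniform on the cylinder and passes to the supremum.\<close>

lemma sup_birkhoff_approx:
  assumes "w \<in> Xn p q n"
  shows "\<bar>Sup ((\<lambda>\<omega>. \<Sum>j<n. phi (shiftn j \<omega>)) ` cyl p q w) - ln (wordval w)\<bar> \<le> 144"
proof -
  let ?S = "\<lambda>\<omega>. \<Sum>j<n. phi (shiftn j \<omega>)"
  have *: "\<bar>?S \<omega> - ln (wordval w)\<bar> \<le> 144" if "\<omega> \<in> cyl p q w" for \<omega>
  proof -
    have "length w = n" using assms by (simp add: Xn_def)
    then have "map \<omega> [0..<n] = w"
      using that by (intro nth_equalityI) (auto simp: cyl_def)
    then show ?thesis
      using birkhoff_sum_phi_approx[of \<omega> n] that by (auto simp: cyl_def XN_def)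
  qed
  obtain \<omega> where \<omega>: "\<omega> \<in> cyl p q w" using cyl_nonempty[OF assms] by blast
  have "Sup (?S ` cyl p q w) \<le> ln (wordval w) + 144"
    using * by (intro cSUP_least cyl_nonempty[OF assms]) (fastforce simp: abs_le_iff)
  moreover have "ln (wordval w) - 144 \<le> Sup (?S ` cyl p q w)"
  proof -
    have "bdd_above (?S ` cyl p q w)"
      using * by (intro bdd_aboveI[of _ "ln (wordval w) + 144"]) (fastforce simp: abs_le_iff)
    then have "?S \<omega> \<le> Sup (?S ` cyl p q w)" by (intro cSUP_upper \<omega>)
    then show ?thesis using *[OF \<omega>] by linarith
  qed
  ultimately show ?thesis by linarith
qed

text \<open>The partition function \<open>Z n\<close> and the collision number agree up to a
  constant factor, which disappears in the growth rate. The rate exists since the collision numbers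
  are supermultiplicative, so \<open>lim\<close> in \<open>pressure\<close> is a true limit.\<close>

theorem collisions_growth:
  assumes "coprime p q" "0 < q" "p \<le> q"
  shows "(\<lambda>n. ln (real (collisions p q n)) / real n) \<longlonglongrightarrow> pressure p q"
proof -
  define u where "u n = ln (real (collisions p q n))" for n
  define Z where "Z n = (\<Sum>w\<in>Xn p q n. exp (Sup ((\<lambda>\<omega>. \<Sum>j<n. phi (shiftn j \<omega>)) ` cyl p q w)))" for n
  define K where "K = 144 + ln (real (2 * q + 1))"
  have pos: "0 < real (collisions p q n)" for n using collisions_pos[of p q n] by simp
  have "convergent (\<lambda>n. u n / real n)"
  proof (rule fekete_superadditive)
    show "0 \<le> u n" for n
      unfolding u_def using collisions_pos[of p q n] by (intro ln_ge_zero) simp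
    show "u m + u n \<le> u (m + n)" for m n
    proof -
      have "u m + u n = ln (real (collisions p q m * collisions p q n))"
        using pos by (simp add: u_def ln_mult)
      also have "\<dots> \<le> u (m + n)"
        unfolding u_def using pos collisions_supermult[of p q m n] collisions_pos
        by (intro ln_mono) (auto simp del: of_nat_mult)
      finally show ?thesis .
    qed
    show "u n \<le> ln 9 * real n" for n
    proof -
      have "u n \<le> ln (real (9 ^ n))"
        unfolding u_def using pos collisions_le[of p q n] by (intro ln_mono) (auto simp del: of_nat_power)
      then show ?thesis by (simp add: ln_realpow mult.commute)
    qed
  qed
  then obtain l where l: "(\<lambda>n. u n / real n) \<longlonglongrightarrow> l" by (auto simp: convergent_def)
  have Z: "u n - K \<le> ln (Z n)" "ln (Z n) \<le> u n + K" for n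
  proof -
    have wv: "0 < wordval w" if "w \<in> Xn p q n" for w using that by (intro wordval_pos) (auto simp: Xn_def)
    have S: "exp (-144) * wordval w \<le> exp (Sup ((\<lambda>\<omega>. \<Sum>j<n. phi (shiftn j \<omega>)) ` cyl p q w))"
      "exp (Sup ((\<lambda>\<omega>. \<Sum>j<n. phi (shiftn j \<omega>)) ` cyl p q w)) \<le> exp 144 * wordval w"
      if "w \<in> Xn p q n" for w
    proof -
      have "exp (-144) * wordval w = exp (ln (wordval w) - 144)" "exp 144 * wordval w = exp (ln (wordval w) + 144)"
        using wv[OF that] by (simp_all add: exp_diff exp_add exp_minus field_simps)
      then show "exp (-144) * wordval w \<le> exp (Sup ((\<lambda>\<omega>. \<Sum>j<n. phi (shiftn j \<omega>)) ` cyl p q w))"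
      "exp (Sup ((\<lambda>\<omega>. \<Sum>j<n. phi (shiftn j \<omega>)) ` cyl p q w)) \<le> exp 144 * wordval w"
        using sup_birkhoff_approx[OF that] by (simp_all add: abs_le_iff)
    qed
    have "exp (-144) * real (collisions p q n) \<le> exp (-144) * (\<Sum>w\<in>Xn p q n. wordval w)"
      using sum_wordval_Xn_ge[OF assms(1,2)] by (intro mult_left_mono) auto
    also have "\<dots> \<le> Z n" unfolding Z_def sum_distrib_left by (intro sum_mono S)
    finally have lower: "exp (-144) * real (collisions p q n) \<le> Z n" .
    have "Z n \<le> exp 144 * (\<Sum>w\<in>Xn p q n. wordval w)"
      unfolding Z_def sum_distrib_left by (intro sum_mono S)
    also have "\<dots> \<le> exp 144 * (real (2 * q + 1) * real (collisions p q n))"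
      using sum_wordval_Xn_le[OF assms] by (intro mult_left_mono) auto
    finally have upper: "Z n \<le> exp 144 * (real (2 * q + 1) * real (collisions p q n))" .
    have Zpos: "0 < Z n" using lower pos[of n] by (smt (verit) exp_gt_zero mult_pos_pos)
    have "ln (exp (-144) * real (collisions p q n)) \<le> ln (Z n)"
      using lower pos[of n] by (intro ln_mono) auto
    then have "u n - 144 \<le> ln (Z n)" using pos[of n] by (simp add: ln_mult u_def)
    moreover have "0 \<le> ln (real (2 * q + 1))" by (intro ln_ge_zero) simp
    ultimately show "u n - K \<le> ln (Z n)" unfolding K_def by linarith
    have "ln (Z n) \<le> ln (exp 144 * (real (2 * q + 1) * real (collisions p q n)))"
      using upper Zpos by (intro ln_mono) auto
    also have "\<dots> = 144 + (ln (real (2 * q + 1)) + u n)"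
      using pos[of n] by (subst ln_mult; simp add: u_def)+
    finally show "ln (Z n) \<le> u n + K" unfolding K_def by linarith
  qed
  have K0: "(\<lambda>n. K * (1 / real n)) \<longlonglongrightarrow> K * 0"
    by (intro tendsto_intros lim_1_over_n)
  have "(\<lambda>n. (1 / real n) * ln (Z n)) \<longlonglongrightarrow> l"
  proof (rule tendsto_sandwich)
    show "(\<lambda>n. u n / real n - K * (1 / real n)) \<longlonglongrightarrow> l"
      using tendsto_diff[OF l K0] by simp
    show "(\<lambda>n. u n / real n + K * (1 / real n)) \<longlonglongrightarrow> l"
      using tendsto_add[OF l K0] by simp
    show "\<forall>\<^sub>F n in sequentially. u n / real n - K * (1 / real n) \<le> (1 / real n) * ln (Z n)"
      using divide_right_mono[OF Z(1)] by (auto simp: diff_divide_distrib intro!: always_eventually)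
    show "\<forall>\<^sub>F n in sequentially. (1 / real n) * ln (Z n) \<le> u n / real n + K * (1 / real n)"
      using divide_right_mono[OF Z(2)] by (auto simp: add_divide_distrib intro!: always_eventually)
  qed
  then have "pressure p q = l"
    unfolding pressure_def Z_def by (rule limI)
  then show ?thesis using l by (simp add: u_def)
qed

section \<open>Hausdorff measure\<close>

lemma hcontent_le:
  assumes "A \<subseteq> (\<Union>i. U i)" "\<And>i. bounded (U i)" "\<And>i. diameter (U i) \<le> \<delta>"
  shows "hcontent s \<delta> A \<le> (\<Sum>i. ennreal (diameter (U i) powr s))"
  unfolding hcontent_def using assms by (intro INF_lower) auto

lemma hcontent_mono: "A \<subseteq> B \<Longrightarrow> hcontent s \<delta> A \<le> hcontent s \<delta> B"
  unfolding hcontent_def by (intro INF_superset_mono) auto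

lemma hcontent_single:
  assumes "bounded V" "diameter V \<le> r" "r \<le> \<delta>" "0 \<le> s"
  shows "hcontent s \<delta> V \<le> ennreal (r powr s)"
proof -
  \<comment> \<open>Padding by empty sets is free because \<open>0 powr s = 0\<close>, also for
    \<open>s = 0\<close>.\<close>
  define U where "U i = (if i = (0::nat) then V else {})" for i
  have r: "0 \<le> r" using diameter_ge_0[OF assms(1)] assms(2) by linarith
  have "hcontent s \<delta> V \<le> (\<Sum>i. ennreal (diameter (U i) powr s))"
  proof (rule hcontent_le)
    show "V \<subseteq> (\<Union>i. U i)" by (auto simp: U_def intro: exI[of _ 0])
    show "bounded (U i)" for i using assms(1) by (simp add: U_def)
    show "diameter (U i) \<le> \<delta>" for i using assms(2,3) r by (simp add: U_def)
  qed
  also have "\<dots> = (\<Sum>i\<in>{0}. ennreal (diameter (U i) powr s))"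
    by (intro suminf_finite) (auto simp: U_def)
  also have "\<dots> \<le> ennreal (r powr s)"
    using assms diameter_ge_0[OF assms(1)] by (auto simp: U_def intro!: ennreal_leI powr_mono2)
  finally show ?thesis .
qed

text \<open>Covers that are optimal up to \<open>e / 2 ^ (n + 1)\<close> are merged into one
  sequence by \<open>prod_decode\<close>.\<close>

lemma hcontent_countable_subadditive:
  "hcontent s \<delta> (\<Union>n. A n) \<le> (\<Sum>n. hcontent s \<delta> (A n))"
proof (rule ennreal_le_epsilon)
  fix e :: real assume fin: "(\<Sum>n. hcontent s \<delta> (A n)) < top" and e: "0 < e"
  have "\<exists>U. A n \<subseteq> (\<Union>i. U i) \<and> (\<forall>i. bounded (U i) \<and> diameter (U i) \<le> \<delta>) \<and>
      (\<Sum>i. ennreal (diameter (U i) powr s)) \<le> hcontent s \<delta> (A n) + ennreal (e * (1/2) ^ Suc n)" for n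
  proof -
    have "hcontent s \<delta> (A n) \<le> (\<Sum>n. hcontent s \<delta> (A n))"
      using sum_le_suminf[of "\<lambda>n. hcontent s \<delta> (A n)" "{n}"] by simp
    then have "hcontent s \<delta> (A n) < top" using fin by (rule le_less_trans)
    then have "hcontent s \<delta> (A n) < hcontent s \<delta> (A n) + ennreal (e * (1/2) ^ Suc n)"
      using e by (cases "hcontent s \<delta> (A n)")
        (auto simp: ennreal_plus[symmetric] ennreal_less_iff simp del: ennreal_plus power_Suc)
    then show ?thesis
      unfolding hcontent_def INF_less_iff by (auto intro: less_imp_le)
  qed
  then obtain U where U: "\<And>n. A n \<subseteq> (\<Union>i. U n i)" "\<And>n i. bounded (U n i)" "\<And>n i. diameter (U n i) \<le> \<delta>"
    "\<And>n. (\<Sum>i. ennreal (diameter (U n i) powr s)) \<le> hcontent s \<delta> (A n) + ennreal (e * (1/2) ^ Suc n)"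
    by metis
  define V where "V k = (case prod_decode k of (n, i) \<Rightarrow> U n i)" for k
  have "hcontent s \<delta> (\<Union>n. A n) \<le> (\<Sum>k. ennreal (diameter (V k) powr s))"
  proof (rule hcontent_le)
    show "(\<Union>n. A n) \<subseteq> (\<Union>k. V k)"
    proof
      fix x assume "x \<in> (\<Union>n. A n)"
      then obtain n i where "x \<in> U n i" using U(1) by blast
      then have "x \<in> V (prod_encode (n, i))" by (simp add: V_def)
      then show "x \<in> (\<Union>k. V k)" by blast
    qed
  qed (auto simp: V_def U split: prod.split)
  also have "\<dots> = (\<Sum>k. (\<lambda>(n, i). ennreal (diameter (U n i) powr s)) (prod_decode k))"
    by (simp add: V_def case_prod_unfold)
  also have "\<dots> = (\<Sum>n. \<Sum>i. ennreal (diameter (U n i) powr s))"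
    by (rule suminf_ennreal_2dimen) simp
  also have "\<dots> \<le> (\<Sum>n. hcontent s \<delta> (A n) + ennreal (e * (1/2) ^ Suc n))"
    by (intro suminf_le U) auto
  also have "\<dots> = (\<Sum>n. hcontent s \<delta> (A n)) + (\<Sum>n. ennreal (e * (1/2) ^ Suc n))"
    by (intro suminf_add[symmetric]) auto
  also have "(\<Sum>n. ennreal (e * (1/2) ^ Suc n)) = ennreal e"
    using sums_mult[OF power_half_series, of e] e by (intro suminf_ennreal_eq) auto
  finally show "hcontent s \<delta> (\<Union>n. A n) \<le> (\<Sum>n. hcontent s \<delta> (A n)) + ennreal e" .
qed

lemma hcontent_finite_Union:
  assumes "finite F" "0 \<le> \<delta>" "0 \<le> s" and V: "\<And>V. V \<in> F \<Longrightarrow> hcontent s \<delta> V \<le> c"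
  shows "hcontent s \<delta> (\<Union>F) \<le> of_nat (card F) * c"
proof -
  obtain f where f: "bij_betw f {..<card F} F"
    using ex_bij_betw_nat_finite[OF assms(1)] by (auto simp: lessThan_atLeast0)
  define A where "A n = (if n < card F then f n else {})" for n
  have img: "f n \<in> F" if "n < card F" for n using f that by (auto simp: bij_betw_def)
  have "\<Union>F \<subseteq> (\<Union>n. A n)"
  proof
    fix x assume "x \<in> \<Union>F"
    then obtain n where "n < card F" "x \<in> f n" using f by (auto simp: bij_betw_def)
    then show "x \<in> (\<Union>n. A n)" by (auto simp: A_def intro!: exI[of _ n])
  qed
  then have "hcontent s \<delta> (\<Union>F) \<le> hcontent s \<delta> (\<Union>n. A n)" by (rule hcontent_mono)
  also have "\<dots> \<le> (\<Sum>n. hcontent s \<delta> (A n))" by (rule hcontent_countable_subadditive)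
  also have "\<dots> = (\<Sum>n<card F. hcontent s \<delta> (A n))"
  proof (rule suminf_finite)
    fix n assume "n \<notin> {..<card F}"
    then have "hcontent s \<delta> (A n) \<le> ennreal (0 powr s)"
      using assms(2,3) by (intro hcontent_single) (auto simp: A_def)
    then show "hcontent s \<delta> (A n) = 0" by simp
  qed simp
  also have "\<dots> \<le> (\<Sum>n<card F. c)"
    by (intro sum_mono) (auto simp: A_def img intro!: V)
  finally show ?thesis by simp
qed

lemma hcontent_le_suminf:
  assumes "A \<subseteq> (\<Union>n. \<Union>(F n))" and fin: "\<And>n. finite (F n)"
    and F: "\<And>n V. V \<in> F n \<Longrightarrow> bounded V \<and> diameter V \<le> r n" and r: "\<And>n. r n \<le> \<delta>" and "0 \<le> \<delta>" "0 \<le> s"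
  shows "hcontent s \<delta> A \<le> (\<Sum>n. ennreal (real (card (F n)) * r n powr s))"
proof -
  have "hcontent s \<delta> A \<le> hcontent s \<delta> (\<Union>n. \<Union>(F n))" by (rule hcontent_mono[OF assms(1)])
  also have "\<dots> \<le> (\<Sum>n. hcontent s \<delta> (\<Union>(F n)))" by (rule hcontent_countable_subadditive)
  also have "\<dots> \<le> (\<Sum>n. of_nat (card (F n)) * ennreal (r n powr s))"
    using assms by (intro suminf_le hcontent_finite_Union hcontent_single) auto
  also have "\<dots> = (\<Sum>n. ennreal (real (card (F n)) * r n powr s))"
    by (simp add: ennreal_mult ennreal_of_nat_eq_real_of_nat)
  finally show ?thesis .
qed

lemma hmeasure_eq_0_iff: "hmeasure s A = 0 \<longleftrightarrow> (\<forall>\<delta>>0. hcontent s \<delta> A = 0)"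
proof -
  have "hmeasure s A \<le> 0 \<longleftrightarrow> (\<forall>\<delta>>0. hcontent s \<delta> A \<le> 0)"
    unfolding hmeasure_def SUP_le_iff by auto
  then show ?thesis by simp
qed

text \<open>This keeps the infimum in \<open>hdim\<close> from being over the empty set. Unit
  intervals starting at \<open>n\<close> and \<open>- n\<close> are cut into
  \<open>M * 2 ^ n\<close> pieces, so the squared lengths over the whole line sum to at most
  \<open>4 / M\<close>.\<close>

lemma hmeasure_2_eq_0: "hmeasure 2 A = 0"
  unfolding hmeasure_eq_0_iff
proof (intro allI impI)
  fix \<delta> :: real assume "0 < \<delta>"
  have *: "hcontent 2 \<delta> A \<le> 0 + ennreal e" if e: "0 < e" for e
  proof -
    obtain M :: nat where M: "M > max (1 / \<delta>) (4 / e)" using reals_Archimedean2 by blast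
    then have M': "1 / \<delta> < M" "4 / e < M" by auto
    then have M0: "M > 0" using \<open>0 < \<delta>\<close> by (metis less_trans of_nat_0_less_iff zero_less_divide_1_iff)
    define m where "m n = M * 2 ^ n" for n
    have m0: "m n > 0" for n using M0 by (simp add: m_def)
    define J where "J n = (\<lambda>(t, j). {t * real n + real j / real (m n)..t * real n + (real j + 1) / real (m n)})" for n
    define F where "F n = J n ` ({-1, 1} \<times> {..<m n})" for n
    have card: "card (F n) \<le> 2 * m n" for n
    proof -
      have "card (F n) \<le> card ({-1, 1::real} \<times> {..<m n})" unfolding F_def by (intro card_image_le) auto
      then show ?thesis by (simp add: card_cartesian_product)
    qed
    have "hcontent 2 \<delta> A \<le> (\<Sum>n. ennreal (real (card (F n)) * (1 / real (m n)) powr 2))"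
    proof (rule hcontent_le_suminf)
      show "A \<subseteq> (\<Union>n. \<Union>(F n))"
      proof
        fix x :: real
        define n where "n = nat \<bar>\<lfloor>x\<rfloor>\<bar>"
        define j where "j = nat \<lfloor>frac x * m n\<rfloor>"
        \<comment> \<open>The sign \<open>t\<close> writes the integer part of \<open>x\<close> as
          \<open>t * n\<close> with a natural number \<open>n\<close>.\<close>
        define t :: real where "t = (if 0 \<le> \<lfloor>x\<rfloor> then 1 else -1)"
        have x: "x = t * real n + frac x" by (auto simp: t_def n_def frac_def)
        have "frac x * real (m n) < 1 * real (m n)"
          using m0[of n] by (intro mult_strict_right_mono frac_lt_1) auto
        then have "\<lfloor>frac x * real (m n)\<rfloor> < int (m n)" by (simp add: floor_less_iff)
        then have j: "j < m n" using m0[of n] by (simp add: j_def nat_less_iff frac_ge_0)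
        have "real j = of_int \<lfloor>frac x * m n\<rfloor>" by (simp add: j_def frac_ge_0)
        then have "real j \<le> frac x * m n" "frac x * m n \<le> real j + 1" by linarith+
        then have "real j / real (m n) \<le> frac x" "frac x \<le> (real j + 1) / real (m n)"
          using m0[of n] by (simp_all add: divide_le_eq le_divide_eq)
        then have "x \<in> J n (t, j)"
          unfolding J_def prod.case atLeastAtMost_iff using x by linarith
        moreover have "(t, j) \<in> {-1, 1} \<times> {..<m n}" using j by (auto simp: t_def)
        ultimately show "x \<in> (\<Union>n. \<Union>(F n))" unfolding F_def by blast
      qed
      show "bounded V \<and> diameter V \<le> 1 / real (m n)" if VF: "V \<in> F n" for n V
      proof -
        obtain t j where "V = J n (t, j)" using VF by (auto simp: F_def)
        then have V: "V = {t * real n + real j / real (m n)..t * real n + (real j + 1) / real (m n)}"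
          by (simp add: J_def)
        have "t * real n + (real j + 1) / real (m n) = t * real n + real j / real (m n) + 1 / real (m n)"
          by (simp add: add_divide_distrib)
        then show ?thesis unfolding V by simp
      qed
      show "1 / real (m n) \<le> \<delta>" for n
      proof -
        have "1 \<le> \<delta> * real M" using M'(1) \<open>0 < \<delta>\<close> by (simp add: field_simps)
        also have "\<dots> \<le> \<delta> * real (m n)" using \<open>0 < \<delta>\<close> by (intro mult_left_mono) (simp_all add: m_def mult_le_cancel_left1)
        finally show ?thesis using m0[of n] by (simp add: divide_le_eq)
      qed
    qed (use \<open>0 < \<delta>\<close> in \<open>auto simp: F_def\<close>)
    also have "\<dots> \<le> (\<Sum>n. ennreal (4 / M * (1/2) ^ Suc n))"
    proof (intro suminf_le ennreal_leI)
      fix n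
      have "real (card (F n)) * (1 / real (m n)) powr 2 \<le> real (2 * m n) * (1 / real (m n)) powr 2"
        using card[of n] by (intro mult_right_mono) (auto simp del: of_nat_mult)
      also have "\<dots> = real (2 * m n) * ((1 / real (m n)) * (1 / real (m n)))"
        by (simp add: powr_numeral power2_eq_square)
      also have "\<dots> = 2 / real (m n)"
        using m0[of n] by simp
      also have "\<dots> = 4 / M * (1/2) ^ Suc n"
        by (simp add: m_def power_divide)
      finally show "real (card (F n)) * (1 / real (m n)) powr 2 \<le> 4 / M * (1/2) ^ Suc n" .
    qed auto
    also have "\<dots> = ennreal (4 / M)"
      using sums_mult[OF power_half_series, of "4 / M"] by (intro suminf_ennreal_eq) auto
    also have "\<dots> \<le> ennreal e" using M'(2) e M0 by (intro ennreal_leI) (simp add: field_simps)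
    finally show ?thesis by simp
  qed
  have "hcontent 2 \<delta> A \<le> 0" by (rule ennreal_le_epsilon) (rule *)
  then show "hcontent 2 \<delta> A = 0" by simp
qed

lemma dimension_set_nonempty: "{s. 0 < s \<and> hmeasure s A = 0} \<noteq> {}"
proof -
  have "2 \<in> {s. 0 < s \<and> hmeasure s A = 0}" by (simp add: hmeasure_2_eq_0)
  then show ?thesis by blast
qed

lemma hdim_ge:
  assumes "\<And>s. 0 < s \<Longrightarrow> hmeasure s A = 0 \<Longrightarrow> L \<le> s"
  shows "L \<le> hdim A"
  unfolding hdim_def by (rule cInf_greatest[OF dimension_set_nonempty]) (use assms in blast)

lemma hdim_nonneg: "0 \<le> hdim A"
  by (rule hdim_ge) simp

lemma hdim_le:
  assumes "0 < s" "hmeasure s A = 0"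
  shows "hdim A \<le> s"
  unfolding hdim_def by (rule cInf_lower) (use assms in \<open>auto intro: bdd_belowI[of _ 0]\<close>)

section \<open>Singularity of the projected measure\<close>

locale gasket_projection =
  fixes p q :: nat and \<mu> :: "real measure"
  assumes q_pos: "0 < q" and mu: "is_mu_theta p q \<mu>"
begin

sublocale prob_space \<mu>
  using mu by (simp add: is_mu_theta_def)

lemma sets_mu [measurable_cong, simp]: "sets \<mu> = sets borel"
  using mu by (simp add: is_mu_theta_def)

lemma space_mu [simp]: "space \<mu> = UNIV"
  using sets_eq_imp_space_eq[OF sets_mu] by simp

lemma prob_UNIV [simp]: "measure \<mu> UNIV = 1"
  using prob_space by simp

lemma image_eq_vimage: "(\<lambda>x. 2 * x - d) ` A = (\<lambda>x::real. (x + d) / 2) -` A"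
proof (intro equalityI subsetI)
  fix x assume "x \<in> (\<lambda>x. (x + d) / 2) -` A"
  then show "x \<in> (\<lambda>x. 2 * x - d) ` A"
    by (intro image_eqI[of _ _ "(x + d) / 2"]) (auto simp: field_simps)
qed auto

lemma emeasure_step:
  assumes "A \<in> sets borel"
  shows "emeasure \<mu> A = (emeasure \<mu> ((\<lambda>x. x / 2) -` A) + emeasure \<mu> ((\<lambda>x. (x + 1) / 2) -` A)
         + emeasure \<mu> ((\<lambda>x. (x + real p / real q) / 2) -` A)) / 3"
  using mu assms image_eq_vimage[of 0] image_eq_vimage by (simp add: is_mu_theta_def)

text \<open>Self-similarity passes from indicators to nonnegative functions by linearity and
  monotone convergence.\<close>

lemma nn_integral_step:
  assumes "f \<in> borel_measurable borel"
  shows "(\<integral>\<^sup>+x. f x \<partial>\<mu>) = ((\<integral>\<^sup>+x. f (x / 2) \<partial>\<mu>) + (\<integral>\<^sup>+x. f ((x + 1) / 2) \<partial>\<mu>)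
    + (\<integral>\<^sup>+x. f ((x + real p / real q) / 2) \<partial>\<mu>)) / 3"
  using assms
proof (induction rule: borel_measurable_induct)
  case (cong f g)
  then have "f = g" by auto
  then show ?case using cong by simp
next
  case (set A)
  have ind: "(\<integral>\<^sup>+x. indicator A (h x) \<partial>\<mu>) = emeasure \<mu> (h -` A)"
    if "h -` A \<in> sets borel" for h
  proof -
    have "indicator A (h x) = (indicator (h -` A) x :: ennreal)" for x by (simp add: indicator_def)
    then show ?thesis using that by simp
  qed
  have vim: "h -` A \<in> sets borel" if "h \<in> borel_measurable borel" for h :: "real \<Rightarrow> real"
    using measurable_sets[OF that set] by simp
  have "(\<lambda>x. x / 2) -` A \<in> sets borel" "(\<lambda>x. (x + 1) / 2) -` A \<in> sets borel"
    "(\<lambda>x. (x + real p / real q) / 2) -` A \<in> sets borel"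
    by (intro vim; measurable)+
  then show ?case
    using emeasure_step[OF set] set by (subst (1 2 3) ind) auto
next
  case (mult u c)
  then show ?case
    by (simp add: nn_integral_cmult ring_distribs ennreal_times_divide)
next
  case (add u v)
  then show ?case
    by (simp add: nn_integral_add add_divide_distrib_ennreal add_ac)
next
  case (seq U)
  have *: "(\<integral>\<^sup>+x. Sup (range U) (h x) \<partial>\<mu>) = (SUP i. \<integral>\<^sup>+x. U i (h x) \<partial>\<mu>)"
    "incseq (\<lambda>i. \<integral>\<^sup>+x. U i (h x) \<partial>\<mu>)"
    if h: "h \<in> borel_measurable borel" for h
  proof -
    have U: "(\<lambda>x. U i (h x)) \<in> borel_measurable \<mu>" for i
      using measurable_compose[OF h seq(1)] by simp
    have inc: "incseq (\<lambda>i x. U i (h x))"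
      using seq(3) by (auto simp: incseq_def le_fun_def)
    show "(\<integral>\<^sup>+x. Sup (range U) (h x) \<partial>\<mu>) = (SUP i. \<integral>\<^sup>+x. U i (h x) \<partial>\<mu>)"
      using nn_integral_monotone_convergence_SUP[OF inc U] by (simp add: image_comp)
    show "incseq (\<lambda>i. \<integral>\<^sup>+x. U i (h x) \<partial>\<mu>)"
      using inc by (auto simp: incseq_def le_fun_def intro!: nn_integral_mono)
  qed
  have h: "(\<lambda>x::real. x / 2) \<in> borel_measurable borel" "(\<lambda>x::real. (x + 1) / 2) \<in> borel_measurable borel"
    "(\<lambda>x::real. (x + real p / real q) / 2) \<in> borel_measurable borel"
    by measurable
  have "(\<integral>\<^sup>+x. Sup (range U) x \<partial>\<mu>) = (SUP i. \<integral>\<^sup>+x. U i x \<partial>\<mu>)"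
    using *(1)[of "\<lambda>x. x"] by simp
  also have "\<dots> = (SUP i. ((\<integral>\<^sup>+x. U i (x / 2) \<partial>\<mu>) + (\<integral>\<^sup>+x. U i ((x + 1) / 2) \<partial>\<mu>)
    + (\<integral>\<^sup>+x. U i ((x + real p / real q) / 2) \<partial>\<mu>)) / 3)"
    by (simp only: seq.IH)
  also have "\<dots> = (SUP i. (\<integral>\<^sup>+x. U i (x / 2) \<partial>\<mu>) + (\<integral>\<^sup>+x. U i ((x + 1) / 2) \<partial>\<mu>)
    + (\<integral>\<^sup>+x. U i ((x + real p / real q) / 2) \<partial>\<mu>)) / 3"
    by (rule SUP_divide_ennreal[symmetric])
  also have "\<dots> = ((SUP i. \<integral>\<^sup>+x. U i (x / 2) \<partial>\<mu>) + (SUP i. \<integral>\<^sup>+x. U i ((x + 1) / 2) \<partial>\<mu>)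
    + (SUP i. \<integral>\<^sup>+x. U i ((x + real p / real q) / 2) \<partial>\<mu>)) / 3"
    using *(2)[OF h(1)] *(2)[OF h(2)] *(2)[OF h(3)]
    by (subst ennreal_SUP_add; simp add: ennreal_SUP_add)
      (auto simp: incseq_def intro!: add_mono)
  finally show ?case by (simp only: *(1)[OF h(1)] *(1)[OF h(2)] *(1)[OF h(3)])
qed

lemma integrable_bounded:
  assumes "f \<in> borel_measurable borel" "\<And>x. \<bar>f x\<bar> \<le> B"
  shows "integrable \<mu> (f :: real \<Rightarrow> real)"
  using assms by (intro integrable_const_bound[of _ B]) auto

text \<open>Adding \<open>B\<close> reduces to nonnegative functions; for a probability measure it
  contributes \<open>B\<close> to every integral.\<close>

lemma integral_step:
  fixes f :: "real \<Rightarrow> real"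
  assumes f [measurable]: "f \<in> borel_measurable borel" and B: "\<And>x. \<bar>f x\<bar> \<le> B"
  shows "(\<integral>x. f x \<partial>\<mu>) = ((\<integral>x. f (x / 2) \<partial>\<mu>) + (\<integral>x. f ((x + 1) / 2) \<partial>\<mu>)
    + (\<integral>x. f ((x + real p / real q) / 2) \<partial>\<mu>)) / 3"
proof -
  have *: "(\<integral>\<^sup>+x. ennreal (f (h x) + B) \<partial>\<mu>) = ennreal ((\<integral>x. f (h x) \<partial>\<mu>) + B)"
    "0 \<le> (\<integral>x. f (h x) \<partial>\<mu>) + B"
    if [measurable]: "h \<in> borel_measurable borel" for h
  proof -
    have i: "integrable \<mu> (\<lambda>x. f (h x))"
      using B by (intro integrable_bounded) auto
    have nonneg: "0 \<le> f y + B" for y using B[of y] by linarith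
    have eq: "(\<integral>x. f (h x) + B \<partial>\<mu>) = (\<integral>x. f (h x) \<partial>\<mu>) + B"
      using i by simp
    show "(\<integral>\<^sup>+x. ennreal (f (h x) + B) \<partial>\<mu>) = ennreal ((\<integral>x. f (h x) \<partial>\<mu>) + B)"
      unfolding eq[symmetric] using i nonneg by (intro nn_integral_eq_integral) auto
    show "0 \<le> (\<integral>x. f (h x) \<partial>\<mu>) + B"
      unfolding eq[symmetric] using nonneg by (intro integral_nonneg_AE) auto
  qed
  have h: "(\<lambda>x::real. x / 2) \<in> borel_measurable borel" "(\<lambda>x::real. (x + 1) / 2) \<in> borel_measurable borel"
    "(\<lambda>x::real. (x + real p / real q) / 2) \<in> borel_measurable borel" "(\<lambda>x::real. x) \<in> borel_measurable borel"
    by measurable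
  have "ennreal ((\<integral>x. f x \<partial>\<mu>) + B) = (ennreal ((\<integral>x. f (x / 2) \<partial>\<mu>) + B) + ennreal ((\<integral>x. f ((x + 1) / 2) \<partial>\<mu>) + B)
    + ennreal ((\<integral>x. f ((x + real p / real q) / 2) \<partial>\<mu>) + B)) / 3"
    using nn_integral_step[of "\<lambda>x. ennreal (f x + B)"]
    by (simp add: *(1)[OF h(1)] *(1)[OF h(2)] *(1)[OF h(3)] *(1)[OF h(4)])
  also have "\<dots> = ennreal ((((\<integral>x. f (x / 2) \<partial>\<mu>) + B) + ((\<integral>x. f ((x + 1) / 2) \<partial>\<mu>) + B)
    + ((\<integral>x. f ((x + real p / real q) / 2) \<partial>\<mu>) + B)) / 3)"
    using *(2)[OF h(1)] *(2)[OF h(2)] *(2)[OF h(3)]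
    by (simp add: ennreal_plus[symmetric] divide_ennreal[symmetric] del: ennreal_plus)
  finally show ?thesis
    using *(2)[OF h(1)] *(2)[OF h(2)] *(2)[OF h(3)] *(2)[OF h(4)] by (subst (asm) ennreal_inj) auto
qed

section \<open>The Fourier transform of the measure\<close>

definition fourier :: "real \<Rightarrow> complex" where
  "fourier t = Complex (\<integral>x. cos (t * x) \<partial>\<mu>) (\<integral>x. sin (t * x) \<partial>\<mu>)"

lemma integrable_trig [simp]: "integrable \<mu> (\<lambda>x. cos (t * x))" "integrable \<mu> (\<lambda>x. sin (t * x))"
  by (simp_all add: integrable_bounded[of _ 1])

text \<open>The addition theorems pull the translation by a digit out of the integral, so the
  transform at \<open>t / 2\<close> is multiplied by the mean of three phases.\<close>

lemma fourier_step:
  "fourier t = (1 + cis (t / 2) + cis (t / 2 * (real p / real q))) / 3 * fourier (t / 2)"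
proof -
  have c: "(\<integral>x. cos (t * ((x + d) / 2)) \<partial>\<mu>) =
      cos (t / 2 * d) * (\<integral>x. cos (t / 2 * x) \<partial>\<mu>) - sin (t / 2 * d) * (\<integral>x. sin (t / 2 * x) \<partial>\<mu>)" for d
  proof -
    have "cos (t * ((x + d) / 2)) = cos (t / 2 * d) * cos (t / 2 * x) - sin (t / 2 * d) * sin (t / 2 * x)" for x
      using cos_add[of "t / 2 * d" "t / 2 * x"] by (simp add: algebra_simps add_divide_distrib)
    then show ?thesis by (simp only: Bochner_Integration.integral_diff integrable_mult_right integrable_trig integral_mult_right_zero)
  qed
  have s: "(\<integral>x. sin (t * ((x + d) / 2)) \<partial>\<mu>) =
      sin (t / 2 * d) * (\<integral>x. cos (t / 2 * x) \<partial>\<mu>) + cos (t / 2 * d) * (\<integral>x. sin (t / 2 * x) \<partial>\<mu>)" for d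
  proof -
    have "sin (t * ((x + d) / 2)) = sin (t / 2 * d) * cos (t / 2 * x) + cos (t / 2 * d) * sin (t / 2 * x)" for x
      using sin_add[of "t / 2 * d" "t / 2 * x"] by (simp add: algebra_simps add_divide_distrib)
    then show ?thesis by (simp only: Bochner_Integration.integral_add integrable_mult_right integrable_trig integral_mult_right_zero)
  qed
  have zero: "(\<integral>x. cos (t * (x / 2)) \<partial>\<mu>) = (\<integral>x. cos (t / 2 * x) \<partial>\<mu>)"
    "(\<integral>x. sin (t * (x / 2)) \<partial>\<mu>) = (\<integral>x. sin (t / 2 * x) \<partial>\<mu>)"
    by simp_all
  have C: "(\<integral>x. cos (t * x) \<partial>\<mu>) = ((\<integral>x. cos (t * (x / 2)) \<partial>\<mu>) + (\<integral>x. cos (t * ((x + 1) / 2)) \<partial>\<mu>)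
    + (\<integral>x. cos (t * ((x + real p / real q) / 2)) \<partial>\<mu>)) / 3"
    by (rule integral_step[of _ 1]) auto
  have S: "(\<integral>x. sin (t * x) \<partial>\<mu>) = ((\<integral>x. sin (t * (x / 2)) \<partial>\<mu>) + (\<integral>x. sin (t * ((x + 1) / 2)) \<partial>\<mu>)
    + (\<integral>x. sin (t * ((x + real p / real q) / 2)) \<partial>\<mu>)) / 3"
    by (rule integral_step[of _ 1]) auto
  show ?thesis
    unfolding fourier_def C S c s zero mult_1_right
    by (simp add: complex_eq_iff ring_distribs add_divide_distrib diff_divide_distrib)
qed

text \<open>A finite part of the product formula for the transform, none of whose factors
  vanishes.\<close>

lemma fourier_nonzero_lift:
  assumes "\<And>i. 1 + cis (t / 2 ^ Suc i) + cis (t / 2 ^ Suc i * (real p / real q)) \<noteq> 0"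
    and "fourier (t / 2 ^ n) \<noteq> 0"
  shows "fourier t \<noteq> 0"
  using assms(2)
proof (induction n)
  case (Suc n)
  have "t / 2 ^ n / 2 = t / 2 ^ Suc n" by simp
  then have "fourier (t / 2 ^ n) = (1 + cis (t / 2 ^ Suc n) + cis (t / 2 ^ Suc n * (real p / real q))) / 3
      * fourier (t / 2 ^ Suc n)"
    using fourier_step[of "t / 2 ^ n"] by (simp only:)
  moreover have "a / 3 * b \<noteq> 0" if "a \<noteq> 0" "b \<noteq> 0" for a b :: complex using that by simp
  ultimately have "fourier (t / 2 ^ n) \<noteq> 0"
    using assms(1) Suc.prems by metis
  then show ?case by (rule Suc.IH)
qed simp

lemma fourier_tendsto_1: "(\<lambda>n. Re (fourier (t / 2 ^ n))) \<longlonglongrightarrow> 1"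
proof -
  have "(\<lambda>n. \<integral>x. cos (t / 2 ^ n * x) \<partial>\<mu>) \<longlonglongrightarrow> (\<integral>x. 1 \<partial>\<mu>)"
  proof (rule integral_dominated_convergence[where w = "\<lambda>_. 1"])
    have "(\<lambda>n. cos (t * x * (1/2) ^ n)) \<longlonglongrightarrow> cos (t * x * 0)" for x
      by (intro tendsto_intros LIMSEQ_realpow_zero) auto
    moreover have "t / 2 ^ n * x = t * x * (1/2) ^ n" for n x by (simp add: power_one_over)
    ultimately show "AE x in \<mu>. (\<lambda>n. cos (t / 2 ^ n * x)) \<longlonglongrightarrow> 1"
      by (intro AE_I2) simp
  qed auto
  then show ?thesis by (simp add: fourier_def)
qed

end

text \<open>If the sum vanished, the first phase would have cosine \<open>- 1 / 2\<close> and be a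
  cube root of unity. Its order also divides a power of two, so it would be 1, a
  contradiction.\<close>

lemma three_units_nonzero:
  fixes a b i :: nat
  shows "1 + cis (2 * pi * a / 2 ^ i) + cis (2 * pi * b / 2 ^ i) \<noteq> 0"
proof
  assume sum0: "1 + cis (2 * pi * a / 2 ^ i) + cis (2 * pi * b / 2 ^ i) = 0"
  define x where "x = 2 * pi * a / 2 ^ i"
  define y where "y = 2 * pi * b / 2 ^ i"
  have "cos y = - 1 - cos x" "sin y = - sin x"
    using sum0 unfolding x_def[symmetric] y_def[symmetric] by (simp_all add: complex_eq_iff)
  then have "(- 1 - cos x)\<^sup>2 + (- sin x)\<^sup>2 = 1"
    using sin_cos_squared_add2[of y] by simp
  then have "1 + 2 * cos x = 0"
    using sin_cos_squared_add[of x] by algebra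
  then have cos: "cos x = - 1 / 2" by simp
  have "cos (3 * x) = 1" unfolding cos_treble_cos by (simp add: cos power3_eq_cube)
  then obtain k :: int where k: "3 * x = k * 2 * pi" by (auto simp: cos_one_2pi_int)
  then have "real_of_int (3 * int a) = real_of_int (k * 2 ^ i)"
    by (simp add: x_def field_simps)
  then have "3 * int a = k * 2 ^ i" by (simp only: of_int_eq_iff)
  then have "2 ^ i dvd 3 * int a" by simp
  moreover have "coprime (2 ^ i :: int) 3" by (simp add: coprime_power_left_iff)
  ultimately have "2 ^ i dvd int a" using coprime_dvd_mult_right_iff by blast
  then obtain l where "int a = 2 ^ i * l" by auto
  then have "real a = 2 ^ i * of_int l" by (metis of_int_mult of_int_numeral of_int_of_nat_eq of_int_power)
  then have "x = 2 * pi * of_int l" by (simp add: x_def)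
  then have "cos x = 1" by (simp add: cos_int_2pin)
  with cos show False by simp
qed

section \<open>Riesz products on dyadic grids\<close>

definition riesz :: "real \<Rightarrow> real \<Rightarrow> nat \<Rightarrow> int \<Rightarrow> real" where
  "riesz c \<alpha> n m = (\<Prod>j<n. 1 + c * cos (2 * pi * (2 ^ j * of_int m / 2 ^ n) - \<alpha>))"

lemma cos_add_2pi_int: "cos (x + 2 * pi * of_int k) = cos x"
  by (simp add: cos_add cos_int_2pin sin_int_2pin)

text \<open>Without its lowest frequency, the product at \<open>m / 2 ^ Suc n\<close> is the product
  of level \<open>n\<close> at the same integer \<open>m\<close>.\<close>

lemma riesz_Suc:
  "riesz c \<alpha> (Suc n) m = (1 + c * cos (2 * pi * (of_int m / 2 ^ Suc n) - \<alpha>)) * riesz c \<alpha> n m"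
  unfolding riesz_def by (subst prod.lessThan_Suc_shift) simp

lemma riesz_periodic: "riesz c \<alpha> n (m + 2 ^ n * l) = riesz c \<alpha> n m"
  unfolding riesz_def
proof (intro prod.cong refl)
  fix j
  have "2 * pi * (2 ^ j * of_int (m + 2 ^ n * l) / 2 ^ n) - \<alpha> =
    (2 * pi * (2 ^ j * of_int m / 2 ^ n) - \<alpha>) + 2 * pi * of_int (2 ^ j * l)"
    by (simp add: field_simps)
  then show "1 + c * cos (2 * pi * (2 ^ j * of_int (m + 2 ^ n * l) / 2 ^ n) - \<alpha>) =
      1 + c * cos (2 * pi * (2 ^ j * of_int m / 2 ^ n) - \<alpha>)"
    by (simp only: cos_add_2pi_int)
qed

lemma sum_lessThan_add: "(\<Sum>m<a + b. f m) = (\<Sum>m<a. f m) + (\<Sum>m<b. f (a + m :: nat))"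
  by (induction b) (simp_all add: add.assoc)

text \<open>The lowest frequency changes sign under translation by half a period, while all the
  others are invariant.\<close>
lemma riesz_sum: "(\<Sum>m<2 ^ n. riesz c \<alpha> n (int m)) = 2 ^ n"
proof (induction n)
  case (Suc n)
  have eq: "riesz c \<alpha> (Suc n) (int m) + riesz c \<alpha> (Suc n) (int (2 ^ n + m)) = 2 * riesz c \<alpha> n (int m)" for m
  proof -
    let ?c = "cos (2 * pi * (of_int (int m) / 2 ^ Suc n) - \<alpha>)"
    have "2 * pi * (of_int (int (2 ^ n + m)) / 2 ^ Suc n) - \<alpha> = (2 * pi * (of_int (int m) / 2 ^ Suc n) - \<alpha>) + pi"
      by (simp add: field_simps)
    then have "cos (2 * pi * (of_int (int (2 ^ n + m)) / 2 ^ Suc n) - \<alpha>) = - ?c"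
      by (simp only: cos_periodic_pi)
    moreover have "riesz c \<alpha> n (int (2 ^ n + m)) = riesz c \<alpha> n (int m)"
      using riesz_periodic[of c \<alpha> n "int m" 1] by (simp add: add.commute)
    ultimately have "riesz c \<alpha> (Suc n) (int m) + riesz c \<alpha> (Suc n) (int (2 ^ n + m)) =
      (1 + c * ?c) * riesz c \<alpha> n (int m) + (1 + c * - ?c) * riesz c \<alpha> n (int m)"
      by (simp only: riesz_Suc)
    then show ?thesis by (simp only: distrib_right)
  qed
  have "(\<Sum>m<2 ^ Suc n. riesz c \<alpha> (Suc n) (int m)) = (\<Sum>m<2 ^ n + 2 ^ n. riesz c \<alpha> (Suc n) (int m))"
    by (simp add: mult_2)
  also have "\<dots> = (\<Sum>m<2 ^ n. 2 * riesz c \<alpha> n (int m))"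
    by (simp only: sum_lessThan_add sum.distrib[symmetric] eq)
  also have "\<dots> = 2 ^ Suc n" using Suc.IH by (simp add: sum_distrib_left[symmetric])
  finally show ?case .
qed (simp add: riesz_def)

lemma exp_le_one_plus: "exp (y - 2 * y\<^sup>2) \<le> 1 + (y::real)" if "\<bar>y\<bar> \<le> 1 / 2"
proof -
  have "\<bar>ln (1 + y) - y\<bar> \<le> 2 * y\<^sup>2" using abs_ln_one_plus_x_minus_x_bound[OF that] .
  then have "y - 2 * y\<^sup>2 \<le> ln (1 + y)" by linarith
  then have "exp (y - 2 * y\<^sup>2) \<le> exp (ln (1 + y))" by simp
  then show ?thesis using that by simp
qed

text \<open>Each factor satisfies \<open>exp (y - 2 * y\<^sup>2) \<le> 1 + y\<close>, so a large
  cosine sum forces a large product.\<close>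

lemma riesz_lower:
  assumes "0 \<le> c" "c \<le> 1 / 2"
  shows "exp (c * (\<Sum>j<n. cos (2 * pi * (2 ^ j * of_int m / 2 ^ n) - \<alpha>)) - 2 * c\<^sup>2 * real n) \<le> riesz c \<alpha> n m"
proof -
  let ?t = "\<lambda>j. cos (2 * pi * (2 ^ j * of_int m / 2 ^ n) - \<alpha>)"
  have "c * (\<Sum>j<n. ?t j) - 2 * c\<^sup>2 * real n = (\<Sum>j<n. c * ?t j - 2 * c\<^sup>2)"
    by (simp add: sum_subtractf sum_distrib_left)
  then have "exp (c * (\<Sum>j<n. ?t j) - 2 * c\<^sup>2 * real n) = (\<Prod>j<n. exp (c * ?t j - 2 * c\<^sup>2))"
    by (simp add: exp_sum)
  also have "\<dots> \<le> riesz c \<alpha> n m"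
    unfolding riesz_def
  proof (intro prod_mono conjI)
    fix j
    have "\<bar>c * ?t j\<bar> \<le> c * 1" unfolding abs_mult using assms(1) by (intro mult_mono) auto
    then have small: "\<bar>c * ?t j\<bar> \<le> c" by simp
    have "(c * ?t j)\<^sup>2 \<le> c\<^sup>2"
      using small assms(1) by (intro abs_le_square_iff[THEN iffD1]) auto
    then have "exp (c * ?t j - 2 * c\<^sup>2) \<le> exp (c * ?t j - 2 * (c * ?t j)\<^sup>2)" by simp
    also have "\<dots> \<le> 1 + c * ?t j" using small assms(2) by (intro exp_le_one_plus) linarith
    finally show "exp (c * ?t j - 2 * c\<^sup>2) \<le> 1 + c * ?t j" .
  qed simp
  finally show ?thesis .
qed

lemma riesz_nonneg:
  assumes "0 \<le> c" "c \<le> 1 / 2"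
  shows "0 \<le> riesz c \<alpha> n m"
  using riesz_lower[OF assms] exp_ge_zero order_trans by blast

text \<open>Markov's inequality, since the mean of the product over the grid is 1.\<close>

lemma card_riesz_large:
  assumes "0 \<le> c" "c \<le> 1 / 2" "0 < y"
  shows "real (card {m. m < 2 ^ n \<and> y \<le> riesz c \<alpha> n (int m)}) \<le> 2 ^ n / y"
proof -
  let ?H = "{m. m < 2 ^ n \<and> y \<le> riesz c \<alpha> n (int m)}"
  have "real (card ?H) * y = (\<Sum>m\<in>?H. y)" by simp
  also have "\<dots> \<le> (\<Sum>m\<in>?H. riesz c \<alpha> n (int m))" by (intro sum_mono) auto
  also have "\<dots> \<le> (\<Sum>m<2 ^ n. riesz c \<alpha> n (int m))"
    using riesz_nonneg[OF assms(1,2)] by (intro sum_mono2) auto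
  also have "\<dots> = 2 ^ n" by (rule riesz_sum)
  finally show ?thesis using assms(3) by (simp add: field_simps)
qed

lemma cos_diff_le: "cos a - cos b \<le> \<bar>a - b\<bar>" for a b :: real
proof -
  have "cos a - cos b = 2 * sin ((a + b) / 2) * sin ((b - a) / 2)" by (rule cos_diff_cos)
  also have "\<dots> \<le> \<bar>2 * sin ((a + b) / 2) * sin ((b - a) / 2)\<bar>" by simp
  also have "\<dots> = 2 * (\<bar>sin ((a + b) / 2)\<bar> * \<bar>sin ((b - a) / 2)\<bar>)" by (simp add: abs_mult)
  also have "\<dots> \<le> 2 * (1 * \<bar>(b - a) / 2\<bar>)"
    by (intro mult_left_mono mult_mono abs_sin_x_le_abs_x) auto
  finally show ?thesis by simp
qed

text \<open>Moving \<open>x\<close> to the left end of its dyadic interval changes the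
  \<open>j\<close>th phase by at most \<open>2 * pi * 2 ^ j / 2 ^ n\<close>, and these errors sum to
  at most \<open>2 * pi\<close>.\<close>

lemma sum_cos_floor:
  fixes x :: real
  shows "(\<Sum>j<n. cos (2 * pi * (2 ^ j * x) - \<alpha>)) \<le>
    (\<Sum>j<n. cos (2 * pi * (2 ^ j * of_int \<lfloor>2 ^ n * x\<rfloor> / 2 ^ n) - \<alpha>)) + 2 * pi"
proof -
  let ?k = "\<lfloor>2 ^ n * x\<rfloor>"
  have "\<bar>2 ^ n * x - ?k\<bar> \<le> 1" by linarith
  have "\<bar>x - ?k / 2 ^ n\<bar> = \<bar>2 ^ n * x - ?k\<bar> / 2 ^ n"
  proof -
    have "x - ?k / 2 ^ n = (2 ^ n * x - ?k) / 2 ^ n" by (simp add: field_simps)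
    then show ?thesis by simp
  qed
  also have "\<dots> \<le> 1 / 2 ^ n" using \<open>\<bar>2 ^ n * x - ?k\<bar> \<le> 1\<close> by (intro divide_right_mono) auto
  finally have x: "\<bar>x - ?k / 2 ^ n\<bar> \<le> 1 / 2 ^ n" .
  have "cos (2 * pi * (2 ^ j * x) - \<alpha>) - cos (2 * pi * (2 ^ j * of_int ?k / 2 ^ n) - \<alpha>) \<le> 2 * pi * 2 ^ j / 2 ^ n" for j
  proof -
    have "cos (2 * pi * (2 ^ j * x) - \<alpha>) - cos (2 * pi * (2 ^ j * of_int ?k / 2 ^ n) - \<alpha>)
      \<le> \<bar>(2 * pi * (2 ^ j * x) - \<alpha>) - (2 * pi * (2 ^ j * of_int ?k / 2 ^ n) - \<alpha>)\<bar>"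
      by (rule cos_diff_le)
    also have "\<dots> = \<bar>2 * pi * 2 ^ j * (x - ?k / 2 ^ n)\<bar>"
      by (intro arg_cong[of _ _ abs]) (simp add: algebra_simps)
    also have "\<dots> = 2 * pi * 2 ^ j * \<bar>x - ?k / 2 ^ n\<bar>" by (simp add: abs_mult)
    also have "\<dots> \<le> 2 * pi * 2 ^ j * (1 / 2 ^ n)" by (intro mult_left_mono x) auto
    finally show ?thesis by simp
  qed
  then have "(\<Sum>j<n. cos (2 * pi * (2 ^ j * x) - \<alpha>) - cos (2 * pi * (2 ^ j * of_int ?k / 2 ^ n) - \<alpha>))
    \<le> (\<Sum>j<n. 2 * pi * 2 ^ j / 2 ^ n)" by (intro sum_mono)
  also have "\<dots> = 2 * pi / 2 ^ n * (\<Sum>j<n. 2 ^ j)" by (simp add: sum_distrib_left)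
  also have "(\<Sum>j<n. 2 ^ j :: real) = 2 ^ n - 1" by (induction n) auto
  also have "2 * pi / 2 ^ n * (2 ^ n - 1 :: real) \<le> 2 * pi"
    by (simp add: field_simps)
  finally show ?thesis by (simp add: sum_subtractf)
qed

section \<open>Cosine averages along the doubling map\<close>

context gasket_projection
begin

text \<open>A Birkhoff sum for the doubling map. The frequency is \<open>q\<close> because
  \<open>q\<close> times every digit 0, 1, p/q is an integer.\<close>

definition birkhoff :: "real \<Rightarrow> nat \<Rightarrow> real \<Rightarrow> real" where
  "birkhoff \<alpha> n x = (\<Sum>j<n. cos (2 * pi * (2 ^ j * (real q * x)) - \<alpha>))"

lemma birkhoff_measurable [measurable]: "birkhoff \<alpha> n \<in> borel_measurable borel"
  unfolding birkhoff_def by measurable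

lemma birkhoff_le: "birkhoff \<alpha> n x \<le> real n"
proof -
  have "birkhoff \<alpha> n x \<le> (\<Sum>j<n. 1)" unfolding birkhoff_def by (intro sum_mono) auto
  then show ?thesis by simp
qed

text \<open>Near frequency 0 the transform is close to 1, and on the way up to
  \<open>2 * pi * q\<close> every factor is a third of a sum 1 + u + v of roots of unity of orders
  that are powers of two.\<close>

lemma fourier_nonzero: "fourier (2 * pi * real q) \<noteq> 0"
proof -
  let ?t = "2 * pi * real q"
  have "\<forall>\<^sub>F n in sequentially. 0 < Re (fourier (?t / 2 ^ n))"
    using fourier_tendsto_1 by (rule order_tendstoD) simp
  then obtain n where "0 < Re (fourier (?t / 2 ^ n))"
    using eventually_happens'[OF sequentially_bot] by blast
  then have "fourier (?t / 2 ^ n) \<noteq> 0" by auto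
  moreover have "1 + cis (?t / 2 ^ Suc i) + cis (?t / 2 ^ Suc i * (real p / real q)) \<noteq> 0" for i
  proof -
    have "?t / 2 ^ Suc i * (real p / real q) = 2 * pi * real p / 2 ^ Suc i"
      using q_pos by simp
    then show ?thesis using three_units_nonzero[of q "Suc i" p] by (simp only: not_False_eq_True)
  qed
  ultimately show ?thesis by (rule fourier_nonzero_lift[rotated])
qed

text \<open>Each of the three contractions changes the phase by a multiple of \<open>2 * pi\<close>,
  so the three integrals in the self-similarity coincide.\<close>

lemma integral_frequency_doubling:
  "(\<integral>x. cos (2 * pi * (2 ^ j * (real q * x)) - \<alpha>) \<partial>\<mu>) = (\<integral>x. cos (2 * pi * (real q * x) - \<alpha>) \<partial>\<mu>)"
proof (induction j)
  case (Suc j)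
  let ?f = "\<lambda>x. cos (2 * pi * (2 ^ Suc j * (real q * x)) - \<alpha>)"
  have shift: "?f ((x + d) / 2) = cos (2 * pi * (2 ^ j * (real q * x)) - \<alpha>)"
    if "real q * d = of_int l" for x d and l :: int
  proof -
    have "2 * pi * (2 ^ Suc j * (real q * ((x + d) / 2))) - \<alpha> =
        (2 * pi * (2 ^ j * (real q * x)) - \<alpha>) + 2 * pi * (2 ^ j * (real q * d))"
      by (simp add: algebra_simps)
    also have "2 ^ j * (real q * d) = of_int (2 ^ j * l)" by (simp add: that)
    finally show ?thesis by (simp only: cos_add_2pi_int)
  qed
  have step: "(\<integral>x. ?f x \<partial>\<mu>) = ((\<integral>x. ?f (x / 2) \<partial>\<mu>) + (\<integral>x. ?f ((x + 1) / 2) \<partial>\<mu>)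
      + (\<integral>x. ?f ((x + real p / real q) / 2) \<partial>\<mu>)) / 3"
    by (rule integral_step[of _ 1]) auto
  have f0: "(\<lambda>x. ?f (x / 2)) = (\<lambda>x. cos (2 * pi * (2 ^ j * (real q * x)) - \<alpha>))"
    using shift[of 0 0] by (simp add: fun_eq_iff)
  have f1: "(\<lambda>x. ?f ((x + 1) / 2)) = (\<lambda>x. cos (2 * pi * (2 ^ j * (real q * x)) - \<alpha>))"
    using shift[of 1 "int q"] by (simp only: fun_eq_iff) simp
  have f2: "(\<lambda>x. ?f ((x + real p / real q) / 2)) = (\<lambda>x. cos (2 * pi * (2 ^ j * (real q * x)) - \<alpha>))"
    using shift[of "real p / real q" "int p"] q_pos by (simp only: fun_eq_iff) simp
  show ?case unfolding step f0 f1 f2 using Suc.IH by simp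
qed simp

text \<open>Subtracting the argument turns the Fourier coefficient into its modulus, and by
  frequency doubling all \<open>n\<close> terms have this mean.\<close>

lemma integral_birkhoff:
  "(\<integral>x. birkhoff (Arg (fourier (2 * pi * real q))) n x \<partial>\<mu>) = real n * cmod (fourier (2 * pi * real q))"
proof -
  define z where "z = fourier (2 * pi * real q)"
  define \<alpha> where "\<alpha> = Arg z"
  have z: "Re z = cmod z * cos \<alpha>" "Im z = cmod z * sin \<alpha>"
    using rcis_cmod_Arg[of z] Re_rcis[of "cmod z" \<alpha>] Im_rcis[of "cmod z" \<alpha>] by (simp_all add: \<alpha>_def)
  have "(\<integral>x. cos (2 * pi * (real q * x) - \<alpha>) \<partial>\<mu>) =
      (\<integral>x. cos \<alpha> * cos (2 * pi * real q * x) + sin \<alpha> * sin (2 * pi * real q * x) \<partial>\<mu>)"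
    by (simp add: cos_diff mult_ac)
  also have "\<dots> = cos \<alpha> * Re z + sin \<alpha> * Im z"
    by (simp only: Bochner_Integration.integral_add integrable_mult_right integrable_trig
        integral_mult_right_zero z_def fourier_def complex.sel)
  also have "\<dots> = cmod z * ((cos \<alpha>)\<^sup>2 + (sin \<alpha>)\<^sup>2)"
    by (simp only: z power2_eq_square ring_distribs mult_ac)
  finally have 1: "(\<integral>x. cos (2 * pi * (real q * x) - \<alpha>) \<partial>\<mu>) = cmod z" by simp
  have "(\<integral>x. birkhoff \<alpha> n x \<partial>\<mu>) = (\<Sum>j<n. \<integral>x. cos (2 * pi * (2 ^ j * (real q * x)) - \<alpha>) \<partial>\<mu>)"
    unfolding birkhoff_def
    by (rule Bochner_Integration.integral_sum) (rule integrable_bounded[of _ 1]; simp)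
  then have "(\<integral>x. birkhoff \<alpha> n x \<partial>\<mu>) = real n * cmod z"
    by (simp add: integral_frequency_doubling 1)
  then show ?thesis unfolding \<alpha>_def z_def .
qed

text \<open>The sum is at most \<open>n\<close> on the event and at most
  \<open>n * \<kappa> / 2\<close> off it, while its mean is \<open>n * \<kappa>\<close>.\<close>

lemma birkhoff_large_mass:
  assumes "0 < n"
  defines "\<kappa> \<equiv> cmod (fourier (2 * pi * real q))" and "\<alpha> \<equiv> Arg (fourier (2 * pi * real q))"
  shows "\<kappa> / 2 \<le> prob {x. real n * \<kappa> / 2 \<le> birkhoff \<alpha> n x}"
proof -
  let ?E = "{x. real n * \<kappa> / 2 \<le> birkhoff \<alpha> n x}"
  have E: "?E \<in> sets borel" by measurable
  have \<kappa>: "0 \<le> \<kappa>" by (simp add: \<kappa>_def)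
  have int: "integrable \<mu> (birkhoff \<alpha> n)"
  proof (rule integrable_bounded)
    show "\<bar>birkhoff \<alpha> n x\<bar> \<le> real n" for x
    proof -
      have "\<bar>birkhoff \<alpha> n x\<bar> \<le> (\<Sum>j<n. \<bar>cos (2 * pi * (2 ^ j * (real q * x)) - \<alpha>)\<bar>)"
        unfolding birkhoff_def by (rule sum_abs)
      also have "\<dots> \<le> (\<Sum>j<n. 1)" by (intro sum_mono) auto
      finally show ?thesis by simp
    qed
  qed measurable
  have "real n * \<kappa> = (\<integral>x. birkhoff \<alpha> n x \<partial>\<mu>)"
    by (simp add: integral_birkhoff \<kappa>_def \<alpha>_def)
  also have "\<dots> \<le> (\<integral>x. real n * indicator ?E x + real n * \<kappa> / 2 \<partial>\<mu>)"
  proof (rule integral_mono[OF int])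
    show "integrable \<mu> (\<lambda>x. real n * indicator ?E x + real n * \<kappa> / 2)"
      using E by (intro Bochner_Integration.integrable_add integrable_mult_right integrable_real_indicator)
        (auto simp: emeasure_eq_measure)
    show "birkhoff \<alpha> n x \<le> real n * indicator ?E x + real n * \<kappa> / 2" for x
      using birkhoff_le[of \<alpha> n x] \<kappa> by (cases "x \<in> ?E") (auto simp: add_increasing2)
  qed
  also have "\<dots> = real n * prob ?E + real n * \<kappa> / 2"
    using E by (subst Bochner_Integration.integral_add) (auto simp: emeasure_eq_measure)
  finally have "real n * (\<kappa> / 2) \<le> real n * prob ?E" by simp
  then show ?thesis using assms(1) by simp
qed

text \<open>Intervals of length \<open>1 / (2 ^ n * q)\<close> are indexed by
  \<open>k = m + 2 ^ n * l\<close>. By periodicity the Riesz product depends only on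
  \<open>m\<close>, while \<open>l\<close> counts the periods within radius
  \<open>R\<close>.\<close>

lemma birkhoff_large_cover:
  assumes c: "0 \<le> c" "c \<le> 1 / 2" and x: "\<bar>x\<bar> \<le> real R" and large: "\<tau> \<le> birkhoff \<alpha> n x"
  shows "\<exists>l\<in>{- int (q * R)..int (q * R)}. \<exists>m<2 ^ n.
    exp (c * (\<tau> - 2 * pi) - 2 * c\<^sup>2 * real n) \<le> riesz c \<alpha> n (int m) \<and>
    x \<in> {of_int (int m + 2 ^ n * l) / (2 ^ n * real q)..(of_int (int m + 2 ^ n * l) + 1) / (2 ^ n * real q)}"
proof -
  define k where "k = \<lfloor>2 ^ n * (real q * x)\<rfloor>"
  define l where "l = k div 2 ^ n"
  define m where "m = nat (k mod 2 ^ n)"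
  have m: "int m = k mod 2 ^ n" by (simp add: m_def)
  have k: "k = int m + 2 ^ n * l" by (simp add: m l_def)
  have "m < 2 ^ n" using m by (metis of_nat_less_iff of_nat_numeral of_nat_power pos_mod_bound zero_less_numeral zero_less_power)
  have "real q * x \<le> real (q * R)" "- real (q * R) \<le> real q * x"
    using x mult_left_mono[of x "real R" "real q"] mult_left_mono[of "- real R" x "real q"] by auto
  then have "2 ^ n * (real q * x) \<le> 2 ^ n * real (q * R)" "2 ^ n * - real (q * R) \<le> 2 ^ n * (real q * x)"
    by (simp_all only: mult_le_cancel_left_pos zero_less_power zero_less_numeral)
  then have "k \<le> \<lfloor>real_of_int (2 ^ n * int (q * R))\<rfloor>" "\<lfloor>real_of_int (2 ^ n * - int (q * R))\<rfloor> \<le> k"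
    unfolding k_def by (auto intro!: floor_mono)
  then have "k \<le> 2 ^ n * int (q * R)" "2 ^ n * - int (q * R) \<le> k"
    by (simp_all only: floor_of_int)
  then have "l \<le> 2 ^ n * int (q * R) div 2 ^ n" "2 ^ n * - int (q * R) div 2 ^ n \<le> l"
    unfolding l_def by (simp_all only: zdiv_mono1 zero_less_power zero_less_numeral)
  moreover have "2 ^ n * a div 2 ^ n = a" for a :: int by simp
  ultimately have l: "l \<in> {- int (q * R)..int (q * R)}" by (simp only: atLeastAtMost_iff)
  have "birkhoff \<alpha> n x \<le> (\<Sum>j<n. cos (2 * pi * (2 ^ j * of_int k / 2 ^ n) - \<alpha>)) + 2 * pi"
    unfolding birkhoff_def k_def by (rule sum_cos_floor)
  then have "c * (\<tau> - 2 * pi) \<le> c * (\<Sum>j<n. cos (2 * pi * (2 ^ j * of_int k / 2 ^ n) - \<alpha>))"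
    using large c by (intro mult_left_mono) auto
  then have "exp (c * (\<tau> - 2 * pi) - 2 * c\<^sup>2 * real n)
      \<le> exp (c * (\<Sum>j<n. cos (2 * pi * (2 ^ j * of_int k / 2 ^ n) - \<alpha>)) - 2 * c\<^sup>2 * real n)" by simp
  also have "\<dots> \<le> riesz c \<alpha> n k" by (rule riesz_lower[OF c])
  also have "\<dots> = riesz c \<alpha> n (int m)" unfolding k by (rule riesz_periodic)
  finally have r: "exp (c * (\<tau> - 2 * pi) - 2 * c\<^sup>2 * real n) \<le> riesz c \<alpha> n (int m)" .
  have "of_int k \<le> 2 ^ n * (real q * x)" "2 ^ n * (real q * x) \<le> of_int k + 1"
    unfolding k_def by linarith+
  then have "x \<in> {of_int k / (2 ^ n * real q)..(of_int k + 1) / (2 ^ n * real q)}"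
    using q_pos by (simp add: divide_le_eq le_divide_eq mult_ac)
  then show ?thesis using l \<open>m < 2 ^ n\<close> r unfolding k by blast
qed

end

text \<open>Level \<open>n\<close> needs about \<open>2 ^ n * exp (- \<beta> * n)\<close> intervals
  of length at most \<open>1 / 2 ^ n\<close>. The exponent uses up half of this gain, so the costs
  still decay like \<open>exp (- \<beta> * n / 2)\<close>.\<close>

lemma (in gasket_projection) hmeasure_limsup_birkhoff:
  assumes \<kappa>: "0 < \<kappa>" "\<kappa> \<le> 2"
  defines "\<beta> \<equiv> \<kappa>\<^sup>2 / 32"
  shows "hmeasure (1 - \<beta> / (2 * ln 2)) ((\<Inter>N. \<Union>n\<in>{N..}. {x. real n * \<kappa> / 2 \<le> birkhoff \<alpha> n x}) \<inter> {- real R..real R}) = 0"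
    (is "hmeasure ?s ?A = 0")
  unfolding hmeasure_eq_0_iff
proof (intro allI impI)
  fix \<delta> :: real assume \<delta>: "0 < \<delta>"
  \<comment> \<open>This value maximizes \<open>c * \<kappa> / 2 - 2 * c\<^sup>2\<close>, and the
    maximum is \<open>\<beta>\<close>.\<close>
  define c where "c = \<kappa> / 8"
  have c: "0 < c" "c \<le> 1 / 2" using \<kappa> by (auto simp: c_def)
  define J :: "nat \<Rightarrow> int \<times> nat \<Rightarrow> real set" where
    "J n = (\<lambda>(l, m). {of_int (int m + 2 ^ n * l) / (2 ^ n * real q)..(of_int (int m + 2 ^ n * l) + 1) / (2 ^ n * real q)})" for n
  define H where "H n = {m. m < 2 ^ n \<and> exp (\<beta> * real n - pi) \<le> riesz c \<alpha> n (int m)}" for n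
  define F where "F n = J n ` ({- int (q * R)..int (q * R)} \<times> H n)" for n
  \<comment> \<open>The factor \<open>exp pi\<close> absorbs the rounding loss
    \<open>2 * pi * c\<close>, which is \<open>\<kappa> * pi / 4\<close>.\<close>
  define K where "K = real (2 * (q * R) + 1) * exp pi"
  define \<rho> where "\<rho> = exp (- \<beta> / 2)"
  have \<beta>: "0 < \<beta>" "\<beta> \<le> 1 / 8"
    using \<kappa> power_mono[of \<kappa> 2 2] by (auto simp: \<beta>_def)
  have \<rho>: "0 < \<rho>" "\<rho> < 1" using \<beta> by (auto simp: \<rho>_def)
  have "0 < real (2 * (q * R) + 1)" unfolding of_nat_0_less_iff by simp
  then have K: "0 < K" by (simp only: K_def mult_pos_pos exp_gt_zero)
  have finH: "finite (H n)" for n by (rule finite_subset[of _ "{..<2 ^ n}"]) (auto simp: H_def)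
  have s: "0 \<le> ?s"
  proof -
    have "1 / 2 < ln (2::real)" using ln_2_less_1 ln2_ge_two_thirds by linarith
    then have "\<beta> / (2 * ln 2) \<le> 1" using \<beta> by (simp add: divide_le_eq)
    then show ?thesis by simp
  qed
  have cardF: "real (card (F n)) * (1 / 2 ^ n) powr ?s \<le> K * \<rho> ^ n" for n
  proof -
    have "card (F n) \<le> card ({- int (q * R)..int (q * R)} \<times> H n)"
      unfolding F_def using finH by (intro card_image_le) auto
    also have "\<dots> = (2 * (q * R) + 1) * card (H n)"
    proof -
      have "card {- int (q * R)..int (q * R)} = 2 * (q * R) + 1"
        unfolding card_atLeastAtMost_int by arith
      then show ?thesis by (simp only: card_cartesian_product)
    qed
    finally have "real (card (F n)) \<le> real (2 * (q * R) + 1) * real (card (H n))"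
      by (simp only: of_nat_mult[symmetric] of_nat_le_iff)
    also have "real (card (H n)) \<le> 2 ^ n / exp (\<beta> * real n - pi)"
      unfolding H_def using c by (intro card_riesz_large) auto
    finally have "real (card (F n)) \<le> real (2 * (q * R) + 1) * (2 ^ n / exp (\<beta> * real n - pi))"
      by (simp add: mult_left_mono)
    also have "\<dots> = K * exp (real n * ln 2 - \<beta> * real n)"
      by (simp add: K_def exp_diff exp_of_nat_mult field_simps)
    finally have le: "real (card (F n)) \<le> K * exp (real n * ln 2 - \<beta> * real n)" .
    have pw: "(1 / 2 ^ n) powr ?s = exp (- (real n * ln 2) + \<beta> * real n / 2)"
    proof -
      have "ln (1 / 2 ^ n :: real) = - (real n * ln 2)" by (simp add: ln_div ln_realpow)
      moreover have "?s * - (real n * ln 2) = - (real n * ln 2) + \<beta> * real n / 2"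
        by (simp add: field_simps)
      ultimately show ?thesis unfolding powr_def by simp
    qed
    have "real (card (F n)) * (1 / 2 ^ n) powr ?s
        \<le> K * exp (real n * ln 2 - \<beta> * real n) * exp (- (real n * ln 2) + \<beta> * real n / 2)"
      unfolding pw by (intro mult_right_mono le) auto
    also have "K * exp (real n * ln 2 - \<beta> * real n) * exp (- (real n * ln 2) + \<beta> * real n / 2) = K * exp (real n * (- \<beta> / 2))"
      by (simp only: mult.assoc exp_add[symmetric]) (simp add: field_simps)
    also have "exp (real n * (- \<beta> / 2)) = \<rho> ^ n"
      unfolding \<rho>_def by (rule exp_of_nat_mult)
    finally show ?thesis .
  qed
  \<comment> \<open>The levels from any \<open>N\<close> on cover the limsup set, and their total
    cost is a geometric tail that tends to 0.\<close>
  have cover: "?A \<subseteq> (\<Union>n. \<Union>(F (N + n)))" for N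
  proof
    fix x assume x: "x \<in> ?A"
    then obtain n where n: "N \<le> n" "real n * \<kappa> / 2 \<le> birkhoff \<alpha> n x" by blast
    have "c * (real n * \<kappa> / 2 - 2 * pi) - 2 * c\<^sup>2 * real n = \<beta> * real n - \<kappa> / 4 * pi"
      by (simp add: c_def \<beta>_def power2_eq_square field_simps)
    moreover have "\<kappa> / 4 * pi \<le> 1 * pi" using \<kappa> by (intro mult_right_mono) auto
    ultimately have "exp (\<beta> * real n - pi) \<le> exp (c * (real n * \<kappa> / 2 - 2 * pi) - 2 * c\<^sup>2 * real n)" by simp
    moreover obtain l m where lm: "l \<in> {- int (q * R)..int (q * R)}" "m < 2 ^ n"
      "exp (c * (real n * \<kappa> / 2 - 2 * pi) - 2 * c\<^sup>2 * real n) \<le> riesz c \<alpha> n (int m)" "x \<in> J n (l, m)"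
      using birkhoff_large_cover[of c x R "real n * \<kappa> / 2" \<alpha> n] c x n(2) by (force simp: J_def)
    ultimately have "m \<in> H n" unfolding H_def by (blast intro: order_trans)
    then have "J n (l, m) \<in> F n" using lm by (auto simp: F_def)
    moreover have "n = N + (n - N)" using n(1) by simp
    ultimately have "x \<in> \<Union>(F (N + (n - N)))" using lm(4) by auto
    then show "x \<in> (\<Union>n. \<Union>(F (N + n)))" by blast
  qed
  have FV: "bounded V \<and> diameter V \<le> 1 / 2 ^ n" if V: "V \<in> F n" for V n
  proof -
    obtain l m where "V = J n (l, m)" using V by (auto simp: F_def)
    then have V: "V = {of_int (int m + 2 ^ n * l) / (2 ^ n * real q)..of_int (int m + 2 ^ n * l) / (2 ^ n * real q) + 1 / (2 ^ n * real q)}"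
      by (simp add: J_def add_divide_distrib)
    have "1 / (2 ^ n * real q) \<le> 1 / 2 ^ n"
      using q_pos by (intro divide_left_mono) (auto simp: mult_le_cancel_left1)
    then show ?thesis unfolding V by simp
  qed
  have "hcontent ?s \<delta> ?A \<le> ennreal (K * \<rho> ^ N / (1 - \<rho>))" if N: "1 / 2 ^ N \<le> \<delta>" for N
  proof -
    have "hcontent ?s \<delta> ?A \<le> (\<Sum>n. ennreal (real (card (F (N + n))) * (1 / 2 ^ (N + n)) powr ?s))"
    proof (rule hcontent_le_suminf[OF cover])
      show "finite (F (N + n))" for n unfolding F_def using finH by auto
      show "1 / 2 ^ (N + n) \<le> \<delta>" for n
      proof -
        have "1 / 2 ^ (N + n) \<le> (1 / 2 ^ N :: real)" by (intro divide_left_mono) auto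
        then show ?thesis using N by linarith
      qed
    qed (use FV \<delta> s in auto)
    also have "\<dots> \<le> (\<Sum>n. ennreal (K * \<rho> ^ N * \<rho> ^ n))"
      using cardF[of "N + _"] by (intro suminf_le ennreal_leI) (auto simp: power_add mult_ac)
    also have "\<dots> = ennreal (K * \<rho> ^ N / (1 - \<rho>))"
    proof (rule suminf_ennreal_eq)
      show "0 \<le> K * \<rho> ^ N * \<rho> ^ n" for n using K \<rho> by simp
      show "(\<lambda>n. K * \<rho> ^ N * \<rho> ^ n) sums (K * \<rho> ^ N / (1 - \<rho>))"
        using sums_mult[OF geometric_sums[of \<rho>], of "K * \<rho> ^ N"] \<rho> by simp
    qed
    finally show ?thesis .
  qed
  moreover have "\<forall>\<^sub>F N in sequentially. 1 / 2 ^ N \<le> \<delta>"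
  proof -
    have "(\<lambda>N. (1 / 2 :: real) ^ N) \<longlonglongrightarrow> 0" by (rule LIMSEQ_realpow_zero) auto
    then have "\<forall>\<^sub>F N in sequentially. (1 / 2) ^ N < \<delta>" using \<delta> by (rule order_tendstoD)
    then show ?thesis by eventually_elim (simp add: power_one_over)
  qed
  ultimately have ev: "\<forall>\<^sub>F N in sequentially. hcontent ?s \<delta> ?A \<le> ennreal (K * \<rho> ^ N / (1 - \<rho>))"
    by (auto elim: eventually_mono)
  have "(\<lambda>N. ennreal (K * \<rho> ^ N / (1 - \<rho>))) \<longlonglongrightarrow> ennreal (K * 0 / (1 - \<rho>))"
    using \<rho> by (intro tendsto_ennrealI tendsto_intros LIMSEQ_realpow_zero) auto
  then have "hcontent ?s \<delta> ?A \<le> ennreal (K * 0 / (1 - \<rho>))"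
    by (rule tendsto_lowerbound[OF _ ev]) simp
  then show "hcontent ?s \<delta> ?A = 0" by simp
qed

text \<open>By continuity from above the limsup set has mass at least \<open>\<kappa> / 2\<close>,
  so some bounded part of it has positive mass, and that part has dimension at most
  \<open>s < 1\<close>.\<close>

theorem (in gasket_projection) measure_dim_less_1: "measure_dim \<mu> < 1"
proof -
  define \<kappa> where "\<kappa> = cmod (fourier (2 * pi * real q))"
  define \<alpha> where "\<alpha> = Arg (fourier (2 * pi * real q))"
  define E where "E n = {x. real n * \<kappa> / 2 \<le> birkhoff \<alpha> n x}" for n
  define A where "A = (\<Inter>N. \<Union>n\<in>{N..}. E n)"
  have mass: "\<kappa> / 2 \<le> prob (E n)" if "0 < n" for n
    using birkhoff_large_mass[OF that] by (simp add: E_def \<kappa>_def \<alpha>_def)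
  have \<kappa>0: "0 < \<kappa>" using fourier_nonzero by (simp add: \<kappa>_def)
  \<comment> \<open>A sum of one term is at most 1, so any point of \<open>E 1\<close> yields
    \<open>\<kappa> \<le> 2\<close>.\<close>
  have "prob (E 1) > 0" using mass[of 1] \<kappa>0 by simp
  then have "E 1 \<noteq> {}" by auto
  then obtain x where "\<kappa> / 2 \<le> birkhoff \<alpha> 1 x" by (auto simp: E_def)
  then have \<kappa>2: "\<kappa> \<le> 2" using birkhoff_le[of \<alpha> 1 x] by simp
  have E [measurable]: "E n \<in> sets borel" for n unfolding E_def by measurable
  have UE: "(\<Union>n\<in>{N..}. E n) \<in> sets borel" for N using E by (intro sets.countable_UN') auto
  have A: "A \<in> sets borel" unfolding A_def using UE by (intro sets.countable_INT') auto
  have "(\<lambda>N. prob (\<Union>n\<in>{N..}. E n)) \<longlonglongrightarrow> prob A"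
    unfolding A_def using UE by (intro finite_Lim_measure_decseq) (auto simp: decseq_def, meson atLeast_iff order_trans)
  moreover have "\<kappa> / 2 \<le> prob (\<Union>n\<in>{N..}. E n)" for N
  proof -
    have "\<kappa> / 2 \<le> prob (E (Suc N))" by (rule mass) simp
    also have "\<dots> \<le> prob (\<Union>n\<in>{N..}. E n)" using UE by (intro finite_measure_mono) (auto intro!: bexI[of _ "Suc N"])
    finally show ?thesis .
  qed
  ultimately have "\<kappa> / 2 \<le> prob A" by (intro LIMSEQ_le_const) auto
  then have "emeasure \<mu> A \<noteq> 0" using \<kappa>0 by (simp add: emeasure_eq_measure)
  moreover have "emeasure \<mu> A = 0" if "\<And>R::nat. emeasure \<mu> (A \<inter> {- real R..real R}) = 0"
  proof -
    have "x \<in> (\<Union>R::nat. {- real R..real R})" for x :: real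
    proof -
      obtain R :: nat where "\<bar>x\<bar> \<le> real R" using real_arch_simple by blast
      then have "x \<in> {- real R..real R}" by auto
      then show ?thesis by blast
    qed
    then have "A = (\<Union>R::nat. A \<inter> {- real R..real R})" by auto
    moreover have "emeasure \<mu> (\<Union>R::nat. A \<inter> {- real R..real R}) = 0"
      using that A by (intro emeasure_UN_eq_0) auto
    ultimately show ?thesis by simp
  qed
  ultimately obtain R :: nat where R: "emeasure \<mu> (A \<inter> {- real R..real R}) \<noteq> 0" by blast
  define B where "B = A \<inter> {- real R..real R}"
  define s where "s = 1 - (\<kappa>\<^sup>2 / 32) / (2 * ln 2)"
  have \<kappa>sq: "0 < \<kappa>\<^sup>2" "\<kappa>\<^sup>2 \<le> 4" using \<kappa>0 \<kappa>2 power_mono[of \<kappa> 2 2] by auto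
  moreover have "1 / 2 < ln (2::real)" using ln2_ge_two_thirds by linarith
  ultimately have "0 < (\<kappa>\<^sup>2 / 32) / (2 * ln 2)" "(\<kappa>\<^sup>2 / 32) / (2 * ln 2) < 1"
    by (auto simp: divide_less_eq)
  then have s: "0 < s" "s < 1" by (auto simp: s_def)
  have "hmeasure s B = 0"
    using hmeasure_limsup_birkhoff[OF \<kappa>0 \<kappa>2] by (simp only: s_def B_def A_def E_def)
  then have "hdim B \<le> s" using s(1) by (intro hdim_le)
  moreover have "measure_dim \<mu> \<le> hdim B"
    unfolding measure_dim_def
  proof (rule cInf_lower)
    show "hdim B \<in> {hdim A |A. A \<in> sets \<mu> \<and> 0 < emeasure \<mu> A}"
      using A R by (auto simp: B_def zero_less_iff_neq_zero)
    show "bdd_below {hdim A |A. A \<in> sets \<mu> \<and> 0 < emeasure \<mu> A}"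
      by (rule bdd_belowI[of _ 0]) (auto simp: hdim_nonneg)
  qed
  ultimately show ?thesis using s(2) by linarith
qed

section \<open>Lower bound by the collision rate\<close>

definition cell :: "nat \<Rightarrow> int \<Rightarrow> real set" where
  "cell n m = {x. \<lfloor>2 ^ n * x\<rfloor> = m}"

lemma cell_borel [measurable]: "cell n m \<in> sets borel"
  unfolding cell_def by measurable

lemma disjoint_cells: "disjoint_family_on (cell n) F"
  by (auto simp: disjoint_family_on_def cell_def)

context gasket_projection
begin

lemma prob_step:
  assumes "A \<in> sets borel"
  shows "prob A = (\<Sum>d\<in>dig3. prob ((\<lambda>x. (x + (int q * int (snd d) + int p * int (fst d)) / real q) / 2) -` A)) / 3"
proof -
  have "ennreal (prob A) = ennreal ((prob ((\<lambda>x. x / 2) -` A) + prob ((\<lambda>x. (x + 1) / 2) -` A)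
         + prob ((\<lambda>x. (x + real p / real q) / 2) -` A)) / 3)"
    using emeasure_step[OF assms]
    by (simp add: emeasure_eq_measure ennreal_plus[symmetric] divide_ennreal[symmetric] del: ennreal_plus)
  then have "prob A = (prob ((\<lambda>x. x / 2) -` A) + prob ((\<lambda>x. (x + 1) / 2) -` A)
         + prob ((\<lambda>x. (x + real p / real q) / 2) -` A)) / 3"
    by (subst (asm) ennreal_inj) auto
  then show ?thesis using q_pos by (simp add: sum_dig3)
qed

text \<open>Composing \<open>n\<close> contractions translates by the dyadic sum of a word;
  appending a digit is a Horner step of \<open>tval\<close>.\<close>

lemma prob_iterate:
  assumes "A \<in> sets borel"
  shows "prob A = (\<Sum>a\<in>lists_over dig3 n. prob ((\<lambda>x. (x + tval p q a / real q) / 2 ^ n) -` A)) / 3 ^ n"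
proof (induction n)
  case 0
  show ?case by (simp add: tval_def)
next
  case (Suc n)
  have step: "prob ((\<lambda>x. (x + tval p q a / real q) / 2 ^ n) -` A) =
      (\<Sum>d\<in>dig3. prob ((\<lambda>x. (x + tval p q (a @ [d]) / real q) / 2 ^ Suc n) -` A)) / 3" for a
  proof -
    have "(\<lambda>x. (x + tval p q a / real q) / 2 ^ n) -` A \<in> sets borel"
      using assms measurable_sets[of "\<lambda>x. (x + tval p q a / real q) / 2 ^ n" borel borel A] by simp
    note prob_step[OF this]
    moreover have "(\<lambda>x. (x + (int q * int (snd d) + int p * int (fst d)) / real q) / 2) -`
        (\<lambda>x. (x + tval p q a / real q) / 2 ^ n) -` A =
      (\<lambda>x. (x + tval p q (a @ [d]) / real q) / 2 ^ Suc n) -` A" for d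
    proof -
      have "((x + (int q * int (snd d) + int p * int (fst d)) / real q) / 2 + tval p q a / real q) / 2 ^ n
        = (x + tval p q (a @ [d]) / real q) / 2 ^ Suc n" for x
        using q_pos by (simp add: tval_def field_simps)
      then show ?thesis by (simp add: vimage_def)
    qed
    ultimately show ?thesis by simp
  qed
  show ?case
    by (subst Suc.IH) (simp add: step sum_lists_over_Suc sum_divide_distrib)
qed

text \<open>Jensen's inequality replaces the square of the mass of a cell by an average over
  translations of the number of pairs of level-\<open>n\<close> points lying in a common unit interval.\<close>
lemma cell_energy:
  assumes "finite F"
  shows "(\<Sum>m\<in>F. (prob (cell n m))\<^sup>2) \<le> real (2 * q + 1) * real (collisions p q n) / 9 ^ n"
proof -
  let ?L = "lists_over dig3 n"
  define P where "P m x = {a \<in> ?L. \<lfloor>x + tval p q a / real q\<rfloor> = m}" for m and x :: real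
  define N where "N m x = (\<Sum>a\<in>?L. indicator {x. \<lfloor>x + tval p q a / real q\<rfloor> = m} x :: real)" for m x
  have NP: "N m x = real (card (P m x))" for m x
    by (simp add: N_def P_def indicator_def sum.If_cases Int_def)
  have finP: "finite (P m x)" for m x by (simp add: P_def)
  have meas [measurable]: "N m \<in> borel_measurable borel" for m
    unfolding N_def by measurable
  have N_le: "N m x \<le> 3 ^ n" "0 \<le> N m x" for m x
  proof -
    have "card (P m x) \<le> card ?L" unfolding P_def by (intro card_mono) auto
    also have "\<dots> = 3 ^ n" by (simp add: card_lists_over card_dig3)
    finally have "real (card (P m x)) \<le> real (3 ^ n)" by (simp only: of_nat_le_iff)
    then show "N m x \<le> 3 ^ n" "0 \<le> N m x" by (simp_all add: NP)
  qed
  have int: "integrable \<mu> (N m)" "integrable \<mu> (\<lambda>x. (N m x)\<^sup>2)" for m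
  proof -
    show "integrable \<mu> (N m)" using N_le by (intro integrable_bounded[of _ "3 ^ n"]) auto
    have "(N m x)\<^sup>2 \<le> (3 ^ n)\<^sup>2" for x using N_le by (intro power_mono) auto
    then show "integrable \<mu> (\<lambda>x. (N m x)\<^sup>2)" by (intro integrable_bounded[of _ "(3 ^ n)\<^sup>2"]) auto
  qed
  have cell: "prob (cell n m) = expectation (N m) / 3 ^ n" for m
  proof -
    have "(\<lambda>x. (x + tval p q a / real q) / 2 ^ n) -` cell n m = {x. \<lfloor>x + tval p q a / real q\<rfloor> = m}" for a
      by (auto simp: cell_def)
    then have "prob (cell n m) = (\<Sum>a\<in>?L. prob {x. \<lfloor>x + tval p q a / real q\<rfloor> = m}) / 3 ^ n"
      using prob_iterate[OF cell_borel, of n m n] by simp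
    moreover have "expectation (N m) = (\<Sum>a\<in>?L. prob {x. \<lfloor>x + tval p q a / real q\<rfloor> = m})"
      unfolding N_def
    proof (subst Bochner_Integration.integral_sum)
      fix a
      have "{x. \<lfloor>x + tval p q a / real q\<rfloor> = m} \<in> sets \<mu>" by simp measurable
      then show "integrable \<mu> (\<lambda>x. indicat_real {x. \<lfloor>x + tval p q a / real q\<rfloor> = m} x)"
        by (intro integrable_real_indicator) (auto simp: emeasure_eq_measure)
    qed simp
    ultimately show ?thesis by simp
  qed
  \<comment> \<open>For the square, Jensen's inequality is nonnegativity of the variance.\<close>
  have jensen: "(prob (cell n m))\<^sup>2 \<le> expectation (\<lambda>x. (N m x)\<^sup>2) / 9 ^ n" for m
  proof -
    have "(expectation (N m))\<^sup>2 \<le> expectation (\<lambda>x. (N m x)\<^sup>2)"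
      using variance_eq[OF int] variance_positive[of "N m"] by simp
    moreover have "(3 ^ n)\<^sup>2 = (9 ^ n :: real)" by (simp add: power2_eq_square flip: power_mult_distrib)
    ultimately show ?thesis unfolding cell power_divide by (simp add: divide_right_mono)
  qed
  have pairs: "(\<Sum>m\<in>F. (N m x)\<^sup>2) \<le> real (2 * q + 1) * real (collisions p q n)" for x
  proof -
    have "(\<Sum>m\<in>F. (card (P m x))\<^sup>2) = (\<Sum>m\<in>F. card (P m x \<times> P m x))"
      by (simp add: card_cartesian_product power2_eq_square)
    also have "\<dots> = card (\<Union>m\<in>F. P m x \<times> P m x)"
      using assms finP by (intro card_UN_disjoint[symmetric]) (auto simp: P_def)
    also have "\<dots> \<le> card (\<Union>k\<in>{- int q..int q}. {(a, b) \<in> ?L \<times> ?L. tval p q a - tval p q b = k})"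
    proof (rule card_mono)
      show "(\<Union>m\<in>F. P m x \<times> P m x) \<subseteq> (\<Union>k\<in>{- int q..int q}. {(a, b) \<in> ?L \<times> ?L. tval p q a - tval p q b = k})"
      proof clarify
        fix m a b assume "a \<in> P m x" "b \<in> P m x"
        then have ab: "a \<in> ?L" "b \<in> ?L" and fl: "\<lfloor>x + tval p q a / real q\<rfloor> = \<lfloor>x + tval p q b / real q\<rfloor>"
          by (auto simp: P_def)
        \<comment> \<open>Points of a common unit interval differ by at most 1, so the integers
          \<open>tval\<close> differ by at most \<open>q\<close>, which leaves
          \<open>2 * q + 1\<close> differences.\<close>
        have "\<bar>tval p q a / real q - tval p q b / real q\<bar> \<le> 1" using fl by linarith
        then have "\<bar>of_int (tval p q a - tval p q b)\<bar> / real q \<le> 1"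
          by (simp add: diff_divide_distrib[symmetric])
        then have "real_of_int \<bar>tval p q a - tval p q b\<bar> \<le> real_of_int (int q)"
          using q_pos by (simp add: divide_le_eq)
        then have "tval p q a - tval p q b \<in> {- int q..int q}"
          by (simp only: of_int_le_iff) auto
        then show "(a, b) \<in> (\<Union>k\<in>{- int q..int q}. {(a, b) \<in> ?L \<times> ?L. tval p q a - tval p q b = k})"
          using ab by blast
      qed
    qed (auto intro: finite_subset[of _ "?L \<times> ?L"])
    also have "\<dots> \<le> (\<Sum>k\<in>{- int q..int q}. card {(a, b) \<in> ?L \<times> ?L. tval p q a - tval p q b = k})"
      by (rule card_UN_le) simp
    also have "\<dots> \<le> (\<Sum>k\<in>{- int q..int q}. collisions p q n)"
      unfolding collisions_def by (intro sum_mono card_diff_le) simp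
    also have "\<dots> = card {- int q..int q} * collisions p q n" by simp
    also have "card {- int q..int q} = 2 * q + 1"
      unfolding card_atLeastAtMost_int by arith
    finally have "real (\<Sum>m\<in>F. (card (P m x))\<^sup>2) \<le> real ((2 * q + 1) * collisions p q n)"
      by (simp only: of_nat_le_iff)
    then show ?thesis unfolding NP by (simp only: of_nat_sum of_nat_power of_nat_mult)
  qed
  have "(\<Sum>m\<in>F. (prob (cell n m))\<^sup>2) \<le> (\<Sum>m\<in>F. expectation (\<lambda>x. (N m x)\<^sup>2) / 9 ^ n)"
    by (intro sum_mono jensen)
  also have "\<dots> = expectation (\<lambda>x. \<Sum>m\<in>F. (N m x)\<^sup>2) / 9 ^ n"
    by (subst Bochner_Integration.integral_sum[OF int(2)]) (simp add: sum_divide_distrib)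
  also have "\<dots> \<le> real (2 * q + 1) * real (collisions p q n) / 9 ^ n"
  proof (intro divide_right_mono)
    have "expectation (\<lambda>x. \<Sum>m\<in>F. (N m x)\<^sup>2) \<le> expectation (\<lambda>x. real (2 * q + 1) * real (collisions p q n))"
      using int(2) by (intro integral_mono pairs Bochner_Integration.integrable_sum) auto
    then show "expectation (\<lambda>x. \<Sum>m\<in>F. (N m x)\<^sup>2) \<le> real (2 * q + 1) * real (collisions p q n)" by simp
  qed simp
  finally show ?thesis .
qed

end

section \<open>Heavy cells and the mass distribution principle\<close>

context gasket_projection
begin

definition heavy :: "real \<Rightarrow> nat \<Rightarrow> real set" where
  "heavy s n = (\<Union>m\<in>{m. (1 / 2 ^ n) powr s < prob (cell n m)}. cell n m)"

lemma heavy_borel [measurable]: "heavy s n \<in> sets borel"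
  unfolding heavy_def by (intro sets.countable_UN') auto

text \<open>On a heavy cell the mass is at most its square times \<open>(2 ^ n) powr s\<close>, so
  the energy bound applies.\<close>

lemma prob_heavy:
  "prob (heavy s n) \<le> real (2 * q + 1) * (real (collisions p q n) / 9 ^ n * (2 ^ n) powr s)"
proof -
  define F where "F = {m. (1 / 2 ^ n) powr s < prob (cell n m)}"
  have union: "prob (\<Union>m\<in>F'. cell n m) = (\<Sum>m\<in>F'. prob (cell n m))" if "finite F'" for F'
    using that disjoint_cells by (intro finite_measure_finite_Union) auto
  \<comment> \<open>At most \<open>(2 ^ n) powr s\<close> disjoint cells can have mass above
    \<open>(1 / 2 ^ n) powr s\<close>.\<close>
  have "finite F"
  proof (rule ccontr)
    assume "infinite F"
    obtain K :: nat where K: "(2 ^ n) powr s < real K" using reals_Archimedean2 by blast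
    obtain F' where F': "finite F'" "card F' = K" "F' \<subseteq> F"
      using infinite_arbitrarily_large[OF \<open>infinite F\<close>] by blast
    have "real K * (1 / 2 ^ n) powr s = (\<Sum>m\<in>F'. (1 / 2 ^ n) powr s)" using F'(2) by simp
    also have "\<dots> \<le> (\<Sum>m\<in>F'. prob (cell n m))"
      using F'(3) by (intro sum_mono) (auto simp: F_def)
    also have "\<dots> = prob (\<Union>m\<in>F'. cell n m)" by (rule union[OF F'(1), symmetric])
    also have "\<dots> \<le> 1" by simp
    finally have "real K * (1 / 2 ^ n) powr s \<le> 1" .
    moreover have "(1 / 2 ^ n) powr s * (2 ^ n) powr s = 1"
      by (subst powr_mult[symmetric]) auto
    moreover have "real K * ((1 / 2 ^ n) powr s * (2 ^ n) powr s) \<le> 1 * (2 ^ n) powr s"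
      unfolding mult.assoc[symmetric] using calculation(1) by (intro mult_right_mono) auto
    ultimately show False using K by simp
  qed
  have "prob (heavy s n) = (\<Sum>m\<in>F. prob (cell n m))"
    unfolding heavy_def F_def[symmetric] by (rule union[OF \<open>finite F\<close>])
  also have "\<dots> \<le> (\<Sum>m\<in>F. (prob (cell n m))\<^sup>2 * (2 ^ n) powr s)"
  proof (intro sum_mono)
    fix m assume "m \<in> F"
    then have "(1 / 2 ^ n) powr s * (2 ^ n) powr s \<le> prob (cell n m) * (2 ^ n) powr s"
      by (intro mult_right_mono) (auto simp: F_def)
    moreover have "(1 / 2 ^ n) powr s * (2 ^ n) powr s = 1"
      by (subst powr_mult[symmetric]) auto
    ultimately have "1 \<le> prob (cell n m) * (2 ^ n) powr s" by simp
    then have "prob (cell n m) * 1 \<le> prob (cell n m) * (prob (cell n m) * (2 ^ n) powr s)"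
      by (intro mult_left_mono) auto
    then show "prob (cell n m) \<le> (prob (cell n m))\<^sup>2 * (2 ^ n) powr s" by (simp add: power2_eq_square mult.assoc)
  qed
  also have "\<dots> = (\<Sum>m\<in>F. (prob (cell n m))\<^sup>2) * (2 ^ n) powr s"
    by (simp add: sum_distrib_right)
  also have "\<dots> \<le> real (2 * q + 1) * real (collisions p q n) / 9 ^ n * (2 ^ n) powr s"
    by (intro mult_right_mono cell_energy[OF \<open>finite F\<close>]) auto
  finally show ?thesis by simp
qed

lemma prob_light_cell:
  assumes "N \<le> n" "G \<inter> (\<Union>n. heavy s (n + N)) = {}"
  shows "prob (cell n m \<inter> G) \<le> (1 / 2 ^ n) powr s"
proof (cases "(1 / 2 ^ n) powr s < prob (cell n m)")
  case True
  then have "cell n m \<subseteq> heavy s n" by (auto simp: heavy_def)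
  moreover have "heavy s n = heavy s ((n - N) + N)" using assms(1) by simp
  ultimately have "cell n m \<inter> G = {}" using assms(2) by blast
  then show ?thesis by simp
next
  case False
  have "prob (cell n m \<inter> G) \<le> prob (cell n m)"
    by (intro finite_measure_mono) auto
  then show ?thesis using False by linarith
qed

text \<open>The set lies in three adjacent cells of a level \<open>n\<close> with
  \<open>1 / 2 ^ n \<le> 2 * r\<close>, where \<open>r\<close> is its diameter. The Borel set
  \<open>V\<close> is needed because covering sets are arbitrary.\<close>

lemma light_cover:
  assumes G: "G \<in> sets borel" "G \<inter> (\<Union>n. heavy s (n + N)) = {}" and s: "0 < s"
    and U: "bounded U" "diameter U \<le> 1 / 2 ^ N"
  shows "\<exists>V\<in>sets borel. U \<subseteq> V \<and> prob (V \<inter> G) \<le> 3 * 2 powr s * diameter U powr s"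
proof (cases "U = {}")
  case True
  then show ?thesis by (intro bexI[of _ "{}"]) auto
next
  case False
  then obtain x where x: "x \<in> U" by blast
  have dist: "\<bar>x - y\<bar> \<le> diameter U" if "y \<in> U" for y
    using diameter_bounded_bound[OF U(1) x that] by (simp add: dist_real_def)
  have "0 \<le> diameter U" by (rule diameter_ge_0[OF U(1)])
  show ?thesis
  proof (cases "diameter U = 0")
    \<comment> \<open>The bound is now \<open>0 powr s = 0\<close>, so a point of \<open>G\<close>
      must be shown to carry no mass.\<close>
    case True
    have "U \<subseteq> {x}" using dist True by force
    moreover have "prob ({x} \<inter> G) \<le> 0"
    proof (rule LIMSEQ_le_const)
      have "(\<lambda>n. ((1 / 2) powr s) ^ n) \<longlonglongrightarrow> 0"
        using s powr_less_mono2[of s "1 / 2" 1] by (intro LIMSEQ_realpow_zero) auto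
      then show "(\<lambda>n. (1 / 2 ^ n :: real) powr s) \<longlonglongrightarrow> 0"
        by (simp add: powr_realpow[symmetric] powr_powr mult.commute powr_divide)
      show "\<exists>M. \<forall>n\<ge>M. prob ({x} \<inter> G) \<le> (1 / 2 ^ n) powr s"
      proof (intro exI allI impI)
        fix n assume "N \<le> n"
        have "prob ({x} \<inter> G) \<le> prob (cell n \<lfloor>2 ^ n * x\<rfloor> \<inter> G)"
          using G(1) by (intro finite_measure_mono) (auto simp: cell_def)
        also have "\<dots> \<le> (1 / 2 ^ n) powr s" by (rule prob_light_cell[OF \<open>N \<le> n\<close> G(2)])
        finally show "prob ({x} \<inter> G) \<le> (1 / 2 ^ n) powr s" .
      qed
    qed
    ultimately show ?thesis using True by (intro bexI[of _ "{x}"]) auto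
  next
    case False
    define r where "r = diameter U"
    have r: "0 < r" using False \<open>0 \<le> diameter U\<close> by (simp add: r_def)
    \<comment> \<open>The least \<open>k\<close> exceeds \<open>N\<close>, so
      \<open>n = k - 1\<close> is at least \<open>N\<close> and
      \<open>1 / 2 ^ Suc n < r \<le> 1 / 2 ^ n\<close>.\<close>
    define k where "k = (LEAST k. (1 / 2) ^ k < r)"
    have "\<exists>k. (1 / 2) ^ k < r" using real_arch_pow_inv[OF r, of "1 / 2"] by auto
    then have k: "(1 / 2) ^ k < r" unfolding k_def by (rule LeastI_ex)
    have "N < k"
    proof (rule ccontr)
      assume "\<not> N < k"
      then have "(1 / 2 :: real) ^ N \<le> (1 / 2) ^ k" by (intro power_decreasing) auto
      then show False using k U(2) by (simp add: r_def power_one_over)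
    qed
    then obtain n where n: "k = Suc n" "N \<le> n" by (cases k) auto
    have "\<not> (1 / 2) ^ n < r" using not_less_Least[of n "\<lambda>k. (1 / 2) ^ k < r"] n(1) by (simp add: k_def)
    then have rn: "r \<le> 1 / 2 ^ n" by (simp add: power_one_over)
    have nr: "1 / 2 ^ n \<le> 2 * r" using k n(1) by (simp add: power_one_over field_simps)
    define j where "j = \<lfloor>2 ^ n * x\<rfloor>"
    define V where "V = (\<Union>m\<in>{j - 1, j, j + 1}. cell n m)"
    have "V \<in> sets borel" unfolding V_def by (intro sets.countable_UN') auto
    moreover have "U \<subseteq> V"
    proof
      fix y assume "y \<in> U"
      then have "\<bar>x - y\<bar> \<le> 1 / 2 ^ n" using dist rn by (force simp: r_def)
      then have "2 ^ n * \<bar>x - y\<bar> \<le> 1" by (simp add: field_simps)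
      then have "\<bar>2 ^ n * x - 2 ^ n * y\<bar> \<le> 1" by (simp add: abs_mult flip: right_diff_distrib)
      then have "\<lfloor>2 ^ n * y\<rfloor> \<in> {j - 1, j, j + 1}" unfolding j_def by (auto; linarith)
      then show "y \<in> V" unfolding V_def cell_def by blast
    qed
    moreover have "prob (V \<inter> G) \<le> 3 * 2 powr s * diameter U powr s"
    proof -
      have "V \<inter> G = (\<Union>m\<in>{j - 1, j, j + 1}. cell n m \<inter> G)" by (auto simp: V_def)
      then have "prob (V \<inter> G) \<le> (\<Sum>m\<in>{j - 1, j, j + 1}. prob (cell n m \<inter> G))"
        using G(1) by (simp only:) (intro finite_measure_subadditive_finite, auto)
      also have "\<dots> \<le> (\<Sum>m\<in>{j - 1, j, j + 1}. (1 / 2 ^ n) powr s)"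
        by (intro sum_mono prob_light_cell[OF n(2) G(2)])
      also have "\<dots> = 3 * (1 / 2 ^ n) powr s" by simp
      also have "(1 / 2 ^ n) powr s \<le> (2 * r) powr s" using nr s by (intro powr_mono2) auto
      also have "(2 * r) powr s = 2 powr s * r powr s" using r by (simp add: powr_mult)
      finally show ?thesis by (simp add: r_def)
    qed
    ultimately show ?thesis by blast
  qed
qed

text \<open>Borel-Cantelli and mass distribution: from some level \<open>N\<close> on the heavy
  cells carry less mass than \<open>A\<close>, and on the rest \<open>G\<close> small sets have mass
  at most a constant times the power \<open>s\<close> of the diameter.\<close>

lemma hmeasure_nonzero:
  assumes s: "0 < s" and summable: "summable (\<lambda>n. real (collisions p q n) / 9 ^ n * (2 ^ n) powr s)"
    and A: "A \<in> sets borel" "0 < prob A"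
  shows "hmeasure s A \<noteq> 0"
proof
  assume zero: "hmeasure s A = 0"
  define w where "w n = real (2 * q + 1) * (real (collisions p q n) / 9 ^ n * (2 ^ n) powr s)" for n
  have w: "summable w" unfolding w_def by (rule summable_mult[OF summable])
  have w0: "0 \<le> w n" for n by (simp add: w_def)
  obtain N where N: "norm (\<Sum>n. w (n + N)) < prob A"
    using suminf_exist_split[OF A(2) w] by blast
  have wN: "summable (\<lambda>n. w (n + N))" using w by (subst summable_iff_shift)
  have heavy_le: "prob (heavy s (n + N)) \<le> w (n + N)" for n unfolding w_def by (rule prob_heavy)
  have sum_heavy: "summable (\<lambda>n. prob (heavy s (n + N)))"
    using heavy_le by (intro summable_comparison_test'[OF wN, of 0]) auto
  have "prob (\<Union>n. heavy s (n + N)) \<le> (\<Sum>n. prob (heavy s (n + N)))"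
    by (intro finite_measure_subadditive_countably sum_heavy) auto
  also have "\<dots> \<le> (\<Sum>n. w (n + N))" by (intro suminf_le heavy_le sum_heavy wN)
  also have "\<dots> < prob A" using N by simp
  finally have small: "prob (\<Union>n. heavy s (n + N)) < prob A" .
  define G where "G = A - (\<Union>n. heavy s (n + N))"
  have G: "G \<in> sets borel" "G \<inter> (\<Union>n. heavy s (n + N)) = {}"
    using A(1) by (auto simp: G_def)
  have Gpos: "0 < prob G"
  proof -
    have "A \<subseteq> G \<union> (\<Union>n. heavy s (n + N))" by (auto simp: G_def)
    then have "prob A \<le> prob (G \<union> (\<Union>n. heavy s (n + N)))"
      using G(1) by (intro finite_measure_mono) auto
    also have "\<dots> \<le> prob G + prob (\<Union>n. heavy s (n + N))"
      using G(1) by (intro measure_Un_le) auto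
    finally show ?thesis using small by linarith
  qed
  define K where "K = 3 * 2 powr s"
  have K: "0 < K" by (simp add: K_def)
  have "emeasure \<mu> G / ennreal K \<le> hcontent s (1 / 2 ^ N) A"
    unfolding hcontent_def
  proof (rule INF_greatest)
    fix U :: "nat \<Rightarrow> real set"
    assume "U \<in> {U. A \<subseteq> (\<Union>i. U i) \<and> (\<forall>i. bounded (U i) \<and> diameter (U i) \<le> 1 / 2 ^ N)}"
    then have U: "A \<subseteq> (\<Union>i. U i)" "\<And>i. bounded (U i)" "\<And>i. diameter (U i) \<le> 1 / 2 ^ N" by auto
    have "\<exists>V\<in>sets borel. U i \<subseteq> V \<and> prob (V \<inter> G) \<le> K * diameter (U i) powr s" for i
      unfolding K_def by (rule light_cover[OF G s U(2,3)])
    then obtain V where V: "\<And>i. V i \<in> sets borel" "\<And>i. U i \<subseteq> V i"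
      "\<And>i. prob (V i \<inter> G) \<le> K * diameter (U i) powr s" by metis
    have "G \<subseteq> (\<Union>i. V i \<inter> G)"
    proof
      fix x assume "x \<in> G"
      then obtain i where "x \<in> U i" using U(1) by (auto simp: G_def)
      then have "x \<in> V i \<inter> G" using V(2)[of i] \<open>x \<in> G\<close> by blast
      then show "x \<in> (\<Union>i. V i \<inter> G)" by blast
    qed
    then have "emeasure \<mu> G \<le> emeasure \<mu> (\<Union>i. V i \<inter> G)"
      using V(1) G(1) by (intro emeasure_mono) auto
    also have "\<dots> \<le> (\<Sum>i. emeasure \<mu> (V i \<inter> G))"
      using V(1) G(1) by (intro emeasure_subadditive_countably) auto
    also have "\<dots> \<le> (\<Sum>i. ennreal K * ennreal (diameter (U i) powr s))"
      using V(3) K by (intro suminf_le) (auto simp: emeasure_eq_measure ennreal_mult[symmetric] intro!: ennreal_leI)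
    also have "\<dots> = ennreal K * (\<Sum>i. ennreal (diameter (U i) powr s))"
      by (rule ennreal_suminf_cmult)
    finally show "emeasure \<mu> G / ennreal K \<le> (\<Sum>i. ennreal (diameter (U i) powr s))"
      using K by (intro divide_le_posI_ennreal) (simp_all add: mult.commute)
  qed
  moreover have "hcontent s (1 / 2 ^ N) A = 0"
    using zero unfolding hmeasure_eq_0_iff by simp
  ultimately have "emeasure \<mu> G / ennreal K = 0" by simp
  then have "ennreal (prob G / K) = 0"
    using K by (simp add: emeasure_eq_measure divide_ennreal)
  then show False using Gpos K by (simp add: ennreal_eq_0_iff divide_le_0_iff)
qed

text \<open>For \<open>s\<close> below the bound the series in \<open>hmeasure_nonzero\<close> is
  eventually dominated by a geometric one, so no Borel set of positive mass is null for exponent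
  \<open>s\<close>.\<close>

theorem measure_dim_ge:
  assumes "(\<lambda>n. ln (real (collisions p q n)) / real n) \<longlonglongrightarrow> P"
  shows "log 2 9 - P / ln 2 \<le> measure_dim \<mu>"
  unfolding measure_dim_def
proof (rule cInf_greatest)
  show "{hdim A |A. A \<in> sets \<mu> \<and> 0 < emeasure \<mu> A} \<noteq> {}"
    using emeasure_space_1 by (auto intro!: exI[of _ UNIV])
next
  fix h assume "h \<in> {hdim A |A. A \<in> sets \<mu> \<and> 0 < emeasure \<mu> A}"
  then obtain A where h: "h = hdim A" and A: "A \<in> sets borel" "0 < prob A"
    by (auto simp: emeasure_eq_measure)
  show "log 2 9 - P / ln 2 \<le> h"
    unfolding h
  proof (rule hdim_ge)
    fix s :: real assume s: "0 < s" and zero: "hmeasure s A = 0"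
    show "log 2 9 - P / ln 2 \<le> s"
    proof (rule ccontr)
      assume "\<not> log 2 9 - P / ln 2 \<le> s"
      then have "s < (ln 9 - P) / ln 2" by (simp add: log_def diff_divide_distrib)
      then have "s * ln 2 < ln 9 - P" by (simp add: less_divide_eq)
      \<comment> \<open>Half of the gap absorbs the error in the growth rate; the other half is the
        rate of decay.\<close>
      define \<eta> where "\<eta> = (ln 9 - P - s * ln 2) / 2"
      have \<eta>: "0 < \<eta>" using \<open>s * ln 2 < ln 9 - P\<close> by (simp add: \<eta>_def)
      have "\<forall>\<^sub>F n in sequentially. ln (real (collisions p q n)) / real n < P + \<eta>"
        using assms \<eta> by (intro order_tendstoD) auto
      then have "\<forall>\<^sub>F n in sequentially.
          norm (real (collisions p q n) / 9 ^ n * (2 ^ n) powr s) \<le> exp (- \<eta>) ^ n"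
        using eventually_gt_at_top[of 0]
      proof eventually_elim
        case (elim n)
        have c: "0 < real (collisions p q n)" using collisions_pos[of p q n] by simp
        have "ln (real (collisions p q n)) \<le> (P + \<eta>) * real n"
          using elim by (simp add: divide_less_eq)
        then have "exp (ln (real (collisions p q n))) \<le> exp ((P + \<eta>) * real n)" by simp
        then have "real (collisions p q n) \<le> exp ((P + \<eta>) * real n)" using c by simp
        then have "real (collisions p q n) / 9 ^ n * (2 ^ n) powr s
            \<le> exp ((P + \<eta>) * real n) / 9 ^ n * (2 ^ n) powr s"
          by (intro mult_right_mono divide_right_mono) auto
        also have "\<dots> = exp ((P + \<eta>) * real n) / exp (real n * ln 9) * exp (s * (real n * ln 2))"
        proof -
          have "(9::real) ^ n = exp (real n * ln 9)" by (simp add: exp_of_nat_mult)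
          moreover have "(2 ^ n :: real) powr s = exp (s * (real n * ln 2))" by (simp add: powr_def ln_realpow)
          ultimately show ?thesis by (simp only:)
        qed
        also have "exp ((P + \<eta>) * real n) / exp (real n * ln 9) * exp (s * (real n * ln 2))
            = exp (real n * (- \<eta>))"
        proof -
          have "(P + \<eta>) * real n - real n * ln 9 + s * (real n * ln 2) = real n * (- \<eta>)"
            by (simp add: \<eta>_def field_simps)
          then show ?thesis by (simp only: exp_diff[symmetric] exp_add[symmetric])
        qed
        also have "\<dots> = exp (- \<eta>) ^ n" by (rule exp_of_nat_mult)
        finally show ?case by simp
      qed
      moreover have "summable (\<lambda>n. exp (- \<eta>) ^ n)" using \<eta> by (intro summable_geometric) auto
      ultimately have "summable (\<lambda>n. real (collisions p q n) / 9 ^ n * (2 ^ n) powr s)"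
        by (rule summable_comparison_test_ev)
      then show False using hmeasure_nonzero[OF s _ A] zero by blast
    qed
  qed
qed

end

text \<open>The logarithm of 9 has base 2, so the bound is \<open>(ln 9 - P) / ln 2\<close> for the
  pressure \<open>P\<close>, which is defined with natural logarithms.\<close>

theorem theorem4p4:
  fixes p q :: nat and \<mu> :: "real measure"
  assumes "coprime p q" and "0 < q" and "p \<le> q"
    and "is_mu_theta p q \<mu>"
  shows "1 > measure_dim \<mu> \<and> measure_dim \<mu> \<ge> log 2 9 - pressure p q / ln 2"
proof -
  interpret gasket_projection p q \<mu>
    using assms(2,4) by unfold_locales
  show ?thesis
    using measure_dim_less_1 measure_dim_ge[OF collisions_growth[OF assms(1-3)]] by blast
qed

end
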